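(* Assume that the time to failure in $\mathcal{X}_U$ is uniformly upper-bounded by some $T_f\in\mathbb{T}$, i.e., $t_f(x,u)\le T_f$ for all $x\in\mathcal{X}_U$ and all $u\in\mathfrak{U}$. Then there exists $p^\star\in\mathbb{R}^+$ such that, for all $p>p^\star$, the penalized value function $V_p$ is a safe value function and the zeroth-order condition $$\sup_{\mathcal{X}_U}V_p<\inf_{\mathcal{X}_V}V\quad\text{if }\mathbb{T}=\mathbb{R}^+,$$ $$R_{\mathcal{Q}_U}+\gamma\cdot\sup_{\mathcal{X}_U}V_p<R_{\mathcal{Q}_V}+\gamma\cdot\inf_{\mathcal{X}_V}V\quad\text{if }\mathbb{T}=\mathbb{N}$$ holds, with $$p^\star=\Big[R_{\mathcal{X}_U}\cdot\tau-\inf_{\mathcal{X}_V}V\Big]\cdot e^{\frac{T_f}{\tau}}-R_{\mathcal{X}_U}\cdot\tau\quad\text{if }\mathbb{T}=\mathbb{R}^+,$$ $$p^\star=\Big[R_{\mathcal{X}_U}\cdot\frac{1-\gamma^{T_f+1}}{1-\gamma}+\frac{R_{\mathcal{Q}_U}-R_{\mathcal{Q}_V}}{\gamma}-\inf_{\mathcal{X}_V}V\Big]\cdot\frac{1}{\gamma^{T_f}}\quad\text{if }\mathbb{T}=\mathbb{N}.$$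
   Context: Time set and dynamics. $\mathbb{T}$ is either $\mathbb{R}^+=[0,\infty)$ (with Lebesgue measure) or $\mathbb{N}$ (with counting measure); integrals over $\mathbb{T}$ use the corresponding measure. The state space is $\mathcal{X}\subset\mathbb{R}^n$ and the control space is $\mathcal{U}\subset\mathbb{R}^m$ (in discrete time more general, e.g. finite, sets are allowed). $\mathfrak{U}$ is the set of measurable feedback controllers $u:\mathcal{X}\to\mathcal{U}$. The dynamics are $\dot x(t)=f(x(t),u(x(t)))$ if $\mathbb{T}=\mathbb{R}^+$, and $x_{t+1}=f(x_t,u(x_t))$ if $\mathbb{T}=\mathbb{N}$. $\phi_x^u$ denotes the trajectory starting at $x$ under $u\in\mathfrak{U}$; trajectories are assumed well defined for all time, and continuous if $\mathbb{T}=\mathbb{R}^+$. Failure. $\mathcal{X}_F\subset\mathcal{X}$ is a closed absorbing failure set. The time to failure is $t_f(x,u)=\inf\{t\in\mathbb{T}:\phi_x^u(t)\in\mathcal{X}_F\}\in\mathbb{T}\cup\{\infty\}$. When the trajectory reaches $\mathcal{X}_F$ the system instantly transitions (in discrete time: at the next step) to an invariant sink state, not counted as an element of $\mathcal{X}$, where no reward or penalty is collected. Viability. $\mathcal{X}_V=\{x\in\mathcal{X}:\exists u\in\mathfrak{U},\forall t\in\mathbb{T},\ \phi_x^u(t)\notin\mathcal{X}_F\}$ is the viability kernel and $\mathcal{X}_U=\mathcal{X}\setminus\mathcal{X}_V$. A controller $u$ is safe for $x$ if $\phi_x^u(t)\notin\mathcal{X}_F$ for all $t\in\mathbb{T}$;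 $\mathfrak{U}_{\mathrm{safe}}(x)$ is the set of controllers safe for $x$; $\mathfrak{U}_{\mathrm{safe}}=\bigcap_{x\in\mathcal{X}_V}\mathfrak{U}_{\mathrm{safe}}(x)$ is the set of safe controllers. Return and risk. $r:\mathcal{X}\times\mathcal{U}\to\mathbb{R}$ is bounded and measurable, $\tau>0$ is the discount rate, and $\gamma=e^{-1/\tau}$. The return is $G(x,u)=\int_{\mathbb{T}}e^{-t/\tau}r(\phi_x^u(t),u(\phi_x^u(t)))\,dt$. The discounted risk is $\rho(x,u)=\int_{\mathbb{T}}e^{-t/\tau}\delta_{\mathcal{X}_F}(\phi_x^u(t))\,dt$, with $\delta_{\mathcal{X}_F}$ the Dirac distribution (continuous time) or indicator function (discrete time) of $\mathcal{X}_F$; this is understood as $\rho(x,u)=e^{-t_f(x,u)/\tau}$ (equal to $0$ if $t_f=\infty$). Problems and value functions. The constrained problem $(\mathcal{C})$ is $\sup_{u\in\mathfrak{U}_{\mathrm{safe}}}\mathbb{E}_{x\sim\mu}[G(x,u)]$, where $\mu$ is a probability distribution on initial states with support included in $\mathcal{X}_V$. The constrained value function is $V(x)=\sup_{u\in\mathfrak{U}_{\mathrm{safe}}}G(x,u)$ for $x\in\mathcal{X}_V$. For a penalty $p\in\mathbb{R}^+$, the penalized value function is $V_p(x)=\sup_{u\in\mathfrak{U}}\big(G(x,u)-p\,\rho(x,u)\big)$ for $x\in\mathcal{X}$; the supremum is assumed attained, and controllers $u\in\mathfrak{U}$ attaining it for all $x$ are called optimal controllers of $V_p$. $V_p$ is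 called a safe value function (or "safe") if all of its optimal controllers are both safe (in $\mathfrak{U}_{\mathrm{safe}}$) and optimal with respect to $(\mathcal{C})$. Constants. $R_{\mathcal{X}_U}=\sup_{\mathcal{X}_U\times\mathcal{U}}r$. For $\mathbb{T}=\mathbb{N}$: $\mathcal{Q}_V=f^{-1}(\mathcal{X}_V)\subset\mathcal{X}_V\times\mathcal{U}$ is the set of state-control pairs mapped by $f$ into $\mathcal{X}_V$, $\mathcal{Q}_U=(\mathcal{X}\times\mathcal{U})\setminus\mathcal{Q}_V$, $R_{\mathcal{Q}_U}=\sup_{\mathcal{Q}_U}r$, and $R_{\mathcal{Q}_V}=\inf_{\mathcal{Q}_V}r$.
   Formalization: The printed p* can be negative or too small (e.g. when R_{X_U}·τ < inf V < 0), so it is replaced by max{0, F(0), F(T_f)}, F(T) being the printed formula with T for T_f; this equals max{0, F(T_f)} whenever R_{X_U} ≥ 0 or F(0) ≤ F(T_f). *)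

theory Defs
  imports "HOL-Probability.Probability"
begin

(* time_measure is Lebesgue measure on [0,oo) or counting measure on the naturals (as a subset of
   the reals); its space is the time set.  flow S u x is the trajectory of the feedback controller u
   from x before the sink is taken into account; it is tied to dyn below. *)
record ('x, 'u) control_problem =
  time_measure :: "real measure"
  states :: "'x set"
  controls :: "'u set"
  failure :: "'x set"
  dyn :: "'x \<Rightarrow> 'u \<Rightarrow> 'x"
  flow :: "('x \<Rightarrow> 'u) \<Rightarrow> 'x \<Rightarrow> real \<Rightarrow> 'x"
  reward :: "'x \<Rightarrow> 'u \<Rightarrow> real"
  tau :: real
  init :: "'x measure"

abbreviation times :: "('x, 'u) control_problem \<Rightarrow> real set" where
  "times S \<equiv> space (time_measure S)"

(* Only the values of a controller on the state space matter. *)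
definition controllers ::
  "('x::topological_space, 'u::topological_space) control_problem \<Rightarrow> ('x \<Rightarrow> 'u) set" where
  "controllers S =
     measurable (restrict_space borel (states S)) (restrict_space borel (controls S))"

definition gamma :: "('x, 'u) control_problem \<Rightarrow> real" where
  "gamma S = exp (- 1 / tau S)"

(* Feedback is merely measurable, so the differential equation is read in the sense of
   Caratheodory, i.e. in integral form. *)
definition ct_trajectory ::
  "('x::euclidean_space, 'u) control_problem \<Rightarrow> ('x \<Rightarrow> 'u) \<Rightarrow> 'x \<Rightarrow> (real \<Rightarrow> 'x) \<Rightarrow> bool" where
  "ct_trajectory S u x \<xi> \<longleftrightarrow>
     continuous_on {0..} \<xi> \<and> \<xi> ` {0..} \<subseteq> states S \<and>
     (\<forall>t\<ge>0. (\<lambda>s. dyn S (\<xi> s) (u (\<xi> s))) absolutely_integrable_on {0..t} \<and>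
            \<xi> t = x + integral {0..t} (\<lambda>s. dyn S (\<xi> s) (u (\<xi> s))))"

definition ct_dynamics :: "('x::euclidean_space, 'u::euclidean_space) control_problem \<Rightarrow> bool" where
  "ct_dynamics S \<longleftrightarrow>
     time_measure S = lebesgue_on {0..} \<and>
     (\<forall>u\<in>controllers S. \<forall>x\<in>states S.
        ct_trajectory S u x (flow S u x) \<and>
        (\<forall>\<xi>. ct_trajectory S u x \<xi> \<longrightarrow> (\<forall>t\<ge>0. \<xi> t = flow S u x t)))"

definition dt_dynamics ::
  "('x::topological_space, 'u::topological_space) control_problem \<Rightarrow> bool" where
  "dt_dynamics S \<longleftrightarrow>
     time_measure S = count_space \<nat> \<and>
     (\<forall>x\<in>states S. \<forall>a\<in>controls S. dyn S x a \<in> states S) \<and>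
     (\<forall>u\<in>controllers S. \<forall>x\<in>states S.
        flow S u x 0 = x \<and>
        (\<forall>k::nat. flow S u x (real (Suc k)) =
                  dyn S (flow S u x (real k)) (u (flow S u x (real k)))))"

definition failure_time ::
  "('x, 'u) control_problem \<Rightarrow> 'x \<Rightarrow> ('x \<Rightarrow> 'u) \<Rightarrow> ereal" where
  "failure_time S x u = Inf (ereal ` {t \<in> times S. flow S u x t \<in> failure S})"

(* None is the sink, entered immediately after the failure time.  In discrete time this means that
   the state at the failure time still earns its reward. *)
definition sink_flow ::
  "('x, 'u) control_problem \<Rightarrow> ('x \<Rightarrow> 'u) \<Rightarrow> 'x \<Rightarrow> real \<Rightarrow> 'x option" where
  "sink_flow S u x t = (if ereal t \<le> failure_time S x u then Some (flow S u x t) else None)"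

definition safe_for :: "('x, 'u) control_problem \<Rightarrow> 'x \<Rightarrow> ('x \<Rightarrow> 'u) \<Rightarrow> bool" where
  "safe_for S x u \<longleftrightarrow> (\<forall>t\<in>times S. flow S u x t \<notin> failure S)"

definition viable ::
  "('x::topological_space, 'u::topological_space) control_problem \<Rightarrow> 'x set" where
  "viable S = {x \<in> states S. \<exists>u\<in>controllers S. safe_for S x u}"

definition unviable ::
  "('x::topological_space, 'u::topological_space) control_problem \<Rightarrow> 'x set" where
  "unviable S = states S - viable S"

definition safe_controllers ::
  "('x::topological_space, 'u::topological_space) control_problem \<Rightarrow> ('x \<Rightarrow> 'u) set" where
  "safe_controllers S = {u \<in> controllers S. \<forall>x\<in>viable S. safe_for S x u}"

definition sink_reward ::
  "('x, 'u) control_problem \<Rightarrow> ('x \<Rightarrow> 'u) \<Rightarrow> 'x option \<Rightarrow> real" where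
  "sink_reward S u z = (case z of None \<Rightarrow> 0 | Some y \<Rightarrow> reward S y (u y))"

definition ret :: "('x, 'u) control_problem \<Rightarrow> 'x \<Rightarrow> ('x \<Rightarrow> 'u) \<Rightarrow> real" where
  "ret S x u = (\<integral>t. exp (- t / tau S) * sink_reward S u (sink_flow S u x t) \<partial>(time_measure S))"

definition risk :: "('x, 'u) control_problem \<Rightarrow> 'x \<Rightarrow> ('x \<Rightarrow> 'u) \<Rightarrow> real" where
  "risk S x u =
     (if failure_time S x u = \<infinity> then 0
      else exp (- real_of_ereal (failure_time S x u) / tau S))"

definition constrained_value ::
  "('x::topological_space, 'u::topological_space) control_problem \<Rightarrow> 'x \<Rightarrow> real" where
  "constrained_value S x = (SUP u\<in>safe_controllers S. ret S x u)"

definition penalized_value ::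
  "('x::topological_space, 'u::topological_space) control_problem \<Rightarrow> real \<Rightarrow> 'x \<Rightarrow> real" where
  "penalized_value S p x = (SUP u\<in>controllers S. ret S x u - p * risk S x u)"

definition optimal_constrained ::
  "('x::topological_space, 'u::topological_space) control_problem \<Rightarrow> ('x \<Rightarrow> 'u) \<Rightarrow> bool" where
  "optimal_constrained S u \<longleftrightarrow>
     u \<in> safe_controllers S \<and>
     (\<forall>u'\<in>safe_controllers S. (\<integral>x. ret S x u' \<partial>(init S)) \<le> (\<integral>x. ret S x u \<partial>(init S)))"

definition optimal_penalized ::
  "('x::topological_space, 'u::topological_space) control_problem \<Rightarrow> real \<Rightarrow> ('x \<Rightarrow> 'u) \<Rightarrow> bool" where
  "optimal_penalized S p u \<longleftrightarrow>
     u \<in> controllers S \<and>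
     (\<forall>x\<in>states S. ret S x u - p * risk S x u = penalized_value S p x)"

definition safe_value_function ::
  "('x::topological_space, 'u::topological_space) control_problem \<Rightarrow> real \<Rightarrow> bool" where
  "safe_value_function S p \<longleftrightarrow>
     (\<forall>u. optimal_penalized S p u \<longrightarrow> u \<in> safe_controllers S \<and> optimal_constrained S u)"

(* The last four conjuncts: the supremum defining the penalized value is attained; the expectations
   in the constrained problem are well defined; the sets over which R_unviable and constrained_value
   are formed are nonempty (a real Sup of the empty set is meaningless). *)
definition standing_assumptions ::
  "('x::topological_space, 'u::topological_space) control_problem \<Rightarrow> bool" where
  "standing_assumptions S \<longleftrightarrow>
     0 < tau S \<and>
     closedin (top_of_set (states S)) (failure S) \<and>
     (\<forall>u\<in>controllers S. \<forall>x\<in>failure S. \<forall>t\<in>times S. flow S u x t \<in> failure S) \<and>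
     bounded ((\<lambda>(x, a). reward S x a) ` (states S \<times> controls S)) \<and>
     (\<lambda>(x, a). reward S x a) \<in> borel_measurable (restrict_space borel (states S \<times> controls S)) \<and>
     prob_space (init S) \<and> sets (init S) = sets (restrict_space borel (states S)) \<and>
     (AE x in init S. x \<in> viable S) \<and>
     (\<forall>p\<ge>0. \<forall>x\<in>states S. \<exists>u\<in>controllers S. ret S x u - p * risk S x u = penalized_value S p x) \<and>
     (\<forall>u\<in>safe_controllers S. (\<lambda>x. ret S x u) \<in> borel_measurable (init S)) \<and>
     failure S \<noteq> {} \<and>
     safe_controllers S \<noteq> {}"

definition R_unviable ::
  "('x::topological_space, 'u::topological_space) control_problem \<Rightarrow> real" where
  "R_unviable S = Sup ((\<lambda>(x, a). reward S x a) ` (unviable S \<times> controls S))"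

(* Pairs with a failed state are excluded automatically, because the failure set is absorbing. *)
definition Q_viable ::
  "('x::topological_space, 'u::topological_space) control_problem \<Rightarrow> ('x \<times> 'u) set" where
  "Q_viable S = {(x, a). x \<in> states S \<and> a \<in> controls S \<and> dyn S x a \<in> viable S}"

definition Q_unviable ::
  "('x::topological_space, 'u::topological_space) control_problem \<Rightarrow> ('x \<times> 'u) set" where
  "Q_unviable S = states S \<times> controls S - Q_viable S"

definition R_Q_unviable ::
  "('x::topological_space, 'u::topological_space) control_problem \<Rightarrow> real" where
  "R_Q_unviable S = Sup ((\<lambda>(x, a). reward S x a) ` Q_unviable S)"

definition R_Q_viable ::
  "('x::topological_space, 'u::topological_space) control_problem \<Rightarrow> real" where
  "R_Q_viable S = Inf ((\<lambda>(x, a). reward S x a) ` Q_viable S)"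

definition inf_V ::
  "('x::topological_space, 'u::topological_space) control_problem \<Rightarrow> real" where
  "inf_V S = (INF x\<in>viable S. constrained_value S x)"

definition sup_V_pen ::
  "('x::topological_space, 'u::topological_space) control_problem \<Rightarrow> real \<Rightarrow> real" where
  "sup_V_pen S p = (SUP x\<in>unviable S. penalized_value S p x)"

(* A state that fails at time T under reward R_unviable has penalized return
   R tau (1 - exp (-T / tau)) - p exp (-T / tau), which is below inf_V S iff p > ct_threshold S T.
   This return is monotone in T, so failure times in [0, T] are covered by the thresholds of both
   end points; that of T alone suffices for instance if R_unviable is nonnegative, but not always:
   a state in the failure set has penalized value - p, so p > - inf_V S is also necessary. *)
definition ct_threshold ::
  "('x::topological_space, 'u::topological_space) control_problem \<Rightarrow> real \<Rightarrow> real" where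
  "ct_threshold S T =
     (R_unviable S * tau S - inf_V S) * exp (T / tau S) - R_unviable S * tau S"

definition dt_threshold ::
  "('x::topological_space, 'u::topological_space) control_problem \<Rightarrow> nat \<Rightarrow> real" where
  "dt_threshold S T =
     (R_unviable S * ((1 - gamma S ^ (T + 1)) / (1 - gamma S))
      + (R_Q_unviable S - R_Q_viable S) / gamma S - inf_V S) * (1 / gamma S ^ T)"

end

(* From an unviable state no feedback ever reaches a viable one, so the penalized return from such
   a state is at most the discounted R_unviable collected until failure, minus p times the discount
   at failure.  For p above the thresholds this upper bound is below inf_V S (in discrete time, up
   to the one-step rewards), while on viable states the penalized value is at least inf_V S.  An
   optimal controller whose trajectory from a viable state fails would have to cross this gap: in
   continuous time the penalized value varies continuously along the trajectory; in discrete time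
   deviating once to a safe control, at the last viable state, would be an improvement.  An optimal
   controller that is safe pays no penalty and dominates every safe controller pointwise. *)

theory Submission
  imports Defs
begin

text \<open>The obstacle is that controllers are stationary feedbacks: a controller cannot be
  changed at a chosen time, only on a chosen set of states, and that set must be Borel.
  Concatenation in time is therefore replaced by splicing on a set: on a whole orbit to show that
  unviable states stay unviable, and on a single point for the one-step deviation. A trajectory may
  return to such a set, so the effect of a splice is never read off a single switch. The dynamic
  programming identity is proved for one fixed controller along its own trajectory, up to the
  failure time. It becomes a statement about values only for an optimal controller, whose return
  equals the penalized value at every state. Two thresholds occur because the bound on the penalized
  return is affine in the discount at failure, with a slope whose sign is unknown when rewards are
  negative.\<close>

section \<open>Elementary inequalities on the reals\<close>

text \<open>Iterating the inequality gives \<open>d 0 \<ge> c ^ n * d n \<ge> - (c ^ n * B)\<close>,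
  which tends to 0. It serves for \<open>d\<close> the advantage of a modified feedback, followed
  along its own orbit.\<close>

lemma nonneg_of_discounted_lower_bound:
  fixes d :: "nat \<Rightarrow> real"
  assumes "0 \<le> c" "c < 1" "\<And>n. \<bar>d n\<bar> \<le> B" "\<And>n. c * d (Suc n) \<le> d n"
  shows "0 \<le> d 0"
proof -
  have le: "c ^ n * d n \<le> d 0" for n
  proof (induction n)
    case (Suc n)
    have "c ^ Suc n * d (Suc n) = c ^ n * (c * d (Suc n))" by simp
    also have "\<dots> \<le> c ^ n * d n" using assms by (intro mult_left_mono) auto
    finally show ?case using Suc by simp
  qed simp
  have "- (c ^ n * B) \<le> d 0" for n
  proof -
    have "c ^ n * (- B) \<le> c ^ n * d n"
      using assms(1) assms(3)[of n] by (intro mult_left_mono) (auto simp: abs_le_iff)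
    then show ?thesis using le[of n] by simp
  qed
  moreover have "(\<lambda>n. - (c ^ n * B)) \<longlonglongrightarrow> - (0 * B)"
    using assms by (intro tendsto_intros LIMSEQ_realpow_zero) auto
  ultimately show ?thesis
    by (intro LIMSEQ_le_const2[where X = "\<lambda>n. - (c ^ n * B)" and x = 0]) auto
qed

lemma affine_le_max_endpoints:
  fixes a b q q0 :: real
  assumes "q0 \<le> q" "q \<le> 1"
  shows "a - b * q \<le> max (a - b) (a - b * q0)"
proof (cases "0 \<le> b")
  case True
  then have "b * q0 \<le> b * q" using assms by (intro mult_left_mono)
  then show ?thesis by simp
next
  case False
  then have "b * 1 \<le> b * q" using assms by (intro mult_left_mono_neg) auto
  then show ?thesis by simp
qed

section \<open>Properties shared by both time sets\<close>

text \<open>These are the facts about time and flow through which both time sets are treated at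
  once. \<open>integral_split\<close> cuts at the half-open \<open>{..<t}\<close> because a single
  instant has mass under counting measure. \<open>orbit_borel\<close> is what makes splicing on an
  orbit measurable, and \<open>first_failure\<close> says that the infimum defining the failure time
  is attained.\<close>

locale controlled_flow =
  fixes S :: "('x::topological_space, 'u::topological_space) control_problem"
  assumes standing: "standing_assumptions S"
    and time_zero: "0 \<in> times S"
    and time_nonneg: "\<And>t. t \<in> times S \<Longrightarrow> 0 \<le> t"
    and time_add: "\<And>s t. s \<in> times S \<Longrightarrow> t \<in> times S \<Longrightarrow> s + t \<in> times S"
    and time_diff: "\<And>s t. s \<in> times S \<Longrightarrow> t \<in> times S \<Longrightarrow> s \<le> t \<Longrightarrow> t - s \<in> times S"
    and time_measurable: "(\<lambda>t. t) \<in> borel_measurable (time_measure S)"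
    and discount_integrable: "integrable (time_measure S) (\<lambda>t. exp (- t / tau S))"
    and integral_split: "\<And>(g :: real \<Rightarrow> real) t. integrable (time_measure S) g \<Longrightarrow> t \<in> times S \<Longrightarrow>
          integral\<^sup>L (time_measure S) g =
          (\<integral>s. indicator {..<t} s * g s \<partial>time_measure S) + (\<integral>s. g (t + s) \<partial>time_measure S)"
    and flow_states: "\<And>u x t. u \<in> controllers S \<Longrightarrow> x \<in> states S \<Longrightarrow> t \<in> times S \<Longrightarrow>
          flow S u x t \<in> states S"
    and flow_zero: "\<And>u x. u \<in> controllers S \<Longrightarrow> x \<in> states S \<Longrightarrow> flow S u x 0 = x"
    and flow_add: "\<And>u x s t. u \<in> controllers S \<Longrightarrow> x \<in> states S \<Longrightarrow> s \<in> times S \<Longrightarrow> t \<in> times S \<Longrightarrow>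
          flow S u (flow S u x s) t = flow S u x (s + t)"
    and flow_cong: "\<And>u w x t. u \<in> controllers S \<Longrightarrow> w \<in> controllers S \<Longrightarrow> x \<in> states S \<Longrightarrow>
          (\<And>s. s \<in> times S \<Longrightarrow> u (flow S u x s) = w (flow S u x s)) \<Longrightarrow> t \<in> times S \<Longrightarrow>
          flow S w x t = flow S u x t"
    and orbit_borel: "\<And>u x. u \<in> controllers S \<Longrightarrow> x \<in> states S \<Longrightarrow>
          flow S u x ` times S \<in> sets borel"
    and first_failure: "\<And>u x t. u \<in> controllers S \<Longrightarrow> x \<in> states S \<Longrightarrow> t \<in> times S \<Longrightarrow>
          flow S u x t \<in> failure S \<Longrightarrow>
          \<exists>t\<in>times S. flow S u x t \<in> failure S \<and> (\<forall>s\<in>times S. s < t \<longrightarrow> flow S u x s \<notin> failure S)"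
    and reward_measurable: "\<And>u x. u \<in> controllers S \<Longrightarrow> x \<in> states S \<Longrightarrow>
          (\<lambda>t. reward S (flow S u x t) (u (flow S u x t))) \<in> borel_measurable (time_measure S)"
begin

text \<open>The cut is closed at \<open>t\<close>: in discrete time the state at the failure time
  still earns its reward.\<close>

definition discount_upto :: "real \<Rightarrow> real" where
  "discount_upto t = (\<integral>s. indicator {..t} s * exp (- s / tau S) \<partial>time_measure S)"

definition discounted_reward :: "'x \<Rightarrow> ('x \<Rightarrow> 'u) \<Rightarrow> real \<Rightarrow> real" where
  "discounted_reward x u t = exp (- t / tau S) * sink_reward S u (sink_flow S u x t)"

definition penalized_return :: "real \<Rightarrow> 'x \<Rightarrow> ('x \<Rightarrow> 'u) \<Rightarrow> real" where
  "penalized_return p x u = ret S x u - p * risk S x u"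

lemma tau_pos: "0 < tau S"
  using standing by (simp add: standing_assumptions_def)

lemma failure_subset: "failure S \<subseteq> states S"
  using standing closedin_imp_subset unfolding standing_assumptions_def by blast

lemma absorbing:
  "u \<in> controllers S \<Longrightarrow> x \<in> failure S \<Longrightarrow> t \<in> times S \<Longrightarrow> flow S u x t \<in> failure S"
  using standing by (simp add: standing_assumptions_def)

lemma reward_bound:
  obtains B where "0 \<le> B" "\<And>x a. x \<in> states S \<Longrightarrow> a \<in> controls S \<Longrightarrow> \<bar>reward S x a\<bar> \<le> B"
proof -
  have "bounded ((\<lambda>(x, a). reward S x a) ` (states S \<times> controls S))"
    using standing by (simp add: standing_assumptions_def)
  then obtain B where "0 < B" "\<forall>r\<in>(\<lambda>(x, a). reward S x a) ` (states S \<times> controls S). norm r \<le> B"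
    by (meson bounded_pos)
  then show ?thesis by (intro that[of B]) force+
qed

lemma safe_controllers_nonempty: "safe_controllers S \<noteq> {}"
  using standing by (simp add: standing_assumptions_def)

lemma safe_subset: "safe_controllers S \<subseteq> controllers S"
  by (auto simp: safe_controllers_def)

lemma controllers_nonempty: "controllers S \<noteq> {}"
  using safe_controllers_nonempty safe_subset by blast

lemma control_in: "u \<in> controllers S \<Longrightarrow> x \<in> states S \<Longrightarrow> u x \<in> controls S"
  unfolding controllers_def by (drule measurable_space[where x = x]) (auto simp: space_restrict_space)

section \<open>Viability and invariance of the unviable set\<close>

lemma viable_subset: "viable S \<subseteq> states S"
  by (auto simp: viable_def)

lemma unviable_subset: "unviable S \<subseteq> states S"
  by (auto simp: unviable_def)

lemma failure_not_viable: "x \<in> failure S \<Longrightarrow> x \<notin> viable S"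
  using time_zero flow_zero failure_subset unfolding viable_def safe_for_def by (auto) (metis subsetD)

lemma failure_unviable: "failure S \<subseteq> unviable S"
  using failure_not_viable failure_subset by (auto simp: unviable_def)

lemma unviable_nonempty: "unviable S \<noteq> {}"
  using failure_unviable standing by (auto simp: standing_assumptions_def)

lemma viable_flow:
  assumes "x \<in> viable S" "u \<in> controllers S" "safe_for S x u" "t \<in> times S"
  shows "flow S u x t \<in> viable S"
proof -
  have x: "x \<in> states S" using assms viable_subset by blast
  have "safe_for S (flow S u x t) u"
    using flow_add[OF assms(2) x assms(4)] time_add assms by (auto simp: safe_for_def)
  then show ?thesis using flow_states[OF assms(2) x assms(4)] assms(2) by (auto simp: viable_def)
qed

lemma splice_controller:
  assumes "u \<in> controllers S" "w \<in> controllers S" "A \<in> sets borel"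
  shows "(\<lambda>z. if z \<in> A then u z else w z) \<in> controllers S"
  using assms unfolding controllers_def
  by (intro measurable_If_set) (auto simp: space_restrict_space sets_restrict_space Int_commute)

text \<open>Switching to a controller \<open>v\<close> that is safe for a state \<open>y\<close> only on the \<open>v\<close>-orbit of \<open>y\<close>
  gives a measurable feedback, and a trajectory that ever meets that orbit is safe under it.\<close>

lemma unviable_flow:
  assumes x: "x \<in> unviable S" and u: "u \<in> controllers S" and t: "t \<in> times S"
  shows "flow S u x t \<in> unviable S"
proof (rule ccontr)
  have xs: "x \<in> states S" using x unviable_subset by blast
  define y where "y = flow S u x t"
  assume "flow S u x t \<notin> unviable S"
  then have "y \<in> viable S" using flow_states[OF u xs t] by (auto simp: unviable_def y_def)
  then obtain v where ys: "y \<in> states S" and v: "v \<in> controllers S" and sv: "safe_for S y v"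
    by (auto simp: viable_def)
  define orb where "orb = flow S v y ` times S"
  define w where "w = (\<lambda>z. if z \<in> orb then v z else u z)"
  have w: "w \<in> controllers S"
    unfolding w_def orb_def by (intro splice_controller u v orbit_borel ys)
  \<comment> \<open>If the trajectory of \<open>w\<close> avoided \<open>orb\<close>, then
    \<open>w\<close> would agree with \<open>u\<close> along it, so both trajectories would coincide
    and be at \<open>y\<close> at time \<open>t\<close>; but \<open>y\<close> lies in
    \<open>orb\<close>.\<close>
  have "\<exists>s\<in>times S. flow S w x s \<in> orb"
  proof (rule ccontr)
    assume no: "\<not> ?thesis"
    have "flow S u x t = flow S w x t"
      by (rule flow_cong[OF w u xs _ t]) (use no in \<open>auto simp: w_def\<close>)
    moreover have "y \<in> orb" unfolding orb_def using flow_zero[OF v ys] time_zero by force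
    ultimately show False using no t by (auto simp: y_def)
  qed
  then obtain s r where s: "s \<in> times S" and r: "r \<in> times S" and sr: "flow S w x s = flow S v y r"
    by (auto simp: orb_def)
  let ?z = "flow S v y r"
  have zs: "?z \<in> states S" using flow_states[OF v ys r] .
  have vz: "flow S v ?z q = flow S v y (r + q)" if "q \<in> times S" for q
    using flow_add[OF v ys r that] .
  have "flow S w ?z q = flow S v ?z q" if "q \<in> times S" for q
    by (rule flow_cong[OF v w zs _ that]) (auto simp: w_def orb_def vz time_add r)
  then have late: "flow S w x (s + q) \<notin> failure S" if "q \<in> times S" for q
    using that vz[OF that] sv time_add[OF r that] flow_add[OF w xs s that] sr
    unfolding safe_for_def by metis
  \<comment> \<open>\<open>late\<close> only covers times from \<open>s\<close> on. An earlier
    failure is excluded by absorption, since it would persist until \<open>s + q\<close>.\<close>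
  have "flow S w x q \<notin> failure S" if q: "q \<in> times S" for q
  proof
    assume "flow S w x q \<in> failure S"
    from absorbing[OF w this s] have "flow S w x (s + q) \<in> failure S"
      using flow_add[OF w xs q s] by (simp add: add.commute)
    then show False using late[OF q] by simp
  qed
  then have "safe_for S x w" by (auto simp: safe_for_def)
  then have "x \<in> viable S" using w xs by (auto simp: viable_def)
  then show False using x by (auto simp: unviable_def)
qed

section \<open>Failure time, risk and return\<close>

lemma le_failure_time_iff:
  "ereal s \<le> failure_time S x u \<longleftrightarrow> (\<forall>t\<in>times S. flow S u x t \<in> failure S \<longrightarrow> s \<le> t)"
  by (auto simp: failure_time_def le_Inf_iff)

lemma failure_time_safe: "safe_for S x u \<Longrightarrow> failure_time S x u = \<infinity>"
  by (simp add: failure_time_def safe_for_def top_ereal_def cong: conj_cong)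

lemma failure_time_eqI:
  assumes "t \<in> times S" "flow S u x t \<in> failure S"
    and "\<And>s. s \<in> times S \<Longrightarrow> s < t \<Longrightarrow> flow S u x s \<notin> failure S"
  shows "failure_time S x u = ereal t"
  unfolding failure_time_def using assms
  by (intro antisym Inf_lower Inf_greatest) (auto simp: not_less[symmetric])

lemma failure_time_cases [consumes 2, case_names safe fails]:
  assumes "u \<in> controllers S" "x \<in> states S"
  obtains (safe) "safe_for S x u" "failure_time S x u = \<infinity>"
  | (fails) t where "t \<in> times S" "flow S u x t \<in> failure S"
      "\<And>s. s \<in> times S \<Longrightarrow> s < t \<Longrightarrow> flow S u x s \<notin> failure S" "failure_time S x u = ereal t"
proof (cases "safe_for S x u")
  case True
  then show ?thesis using failure_time_safe safe by blast
next
  case False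
  then obtain t where "t \<in> times S" "flow S u x t \<in> failure S" by (auto simp: safe_for_def)
  from first_failure[OF assms this] obtain t where
    t: "t \<in> times S" "flow S u x t \<in> failure S"
      "\<And>s. s \<in> times S \<Longrightarrow> s < t \<Longrightarrow> flow S u x s \<notin> failure S" by blast
  show ?thesis by (rule fails[OF t failure_time_eqI[OF t]])
qed

lemma risk_safe: "safe_for S x u \<Longrightarrow> risk S x u = 0"
  by (simp add: risk_def failure_time_safe)

lemma risk_bounds:
  assumes "u \<in> controllers S" "x \<in> states S"
  shows "0 \<le> risk S x u" "risk S x u \<le> 1"
proof -
  have "0 \<le> risk S x u \<and> risk S x u \<le> 1"
    using assms by (cases rule: failure_time_cases) (use tau_pos in \<open>simp_all add: risk_def time_nonneg\<close>)
  then show "0 \<le> risk S x u" "risk S x u \<le> 1" by auto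
qed

lemma discounted_reward_measurable:
  assumes "u \<in> controllers S" "x \<in> states S"
  shows "discounted_reward x u \<in> borel_measurable (time_measure S)"
proof -
  note [measurable] = time_measurable reward_measurable[OF assms]
  have "discounted_reward x u = (\<lambda>t. exp (- t / tau S) *
      (if ereal t \<le> failure_time S x u then reward S (flow S u x t) (u (flow S u x t)) else 0))"
    by (auto simp: discounted_reward_def sink_reward_def sink_flow_def fun_eq_iff)
  also have "\<dots> \<in> borel_measurable (time_measure S)" by measurable
  finally show ?thesis .
qed

lemma discounted_reward_le:
  assumes "u \<in> controllers S" "x \<in> states S" "t \<in> times S" "0 \<le> B"
    and "\<And>x a. x \<in> states S \<Longrightarrow> a \<in> controls S \<Longrightarrow> \<bar>reward S x a\<bar> \<le> B"
  shows "\<bar>discounted_reward x u t\<bar> \<le> B * exp (- t / tau S)"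
  using assms flow_states control_in
  by (auto simp: discounted_reward_def sink_reward_def sink_flow_def abs_mult)

lemma discounted_reward_integrable:
  assumes "u \<in> controllers S" "x \<in> states S"
  shows "integrable (time_measure S) (discounted_reward x u)"
proof -
  obtain B where B: "0 \<le> B" "\<And>x a. x \<in> states S \<Longrightarrow> a \<in> controls S \<Longrightarrow> \<bar>reward S x a\<bar> \<le> B"
    using reward_bound by blast
  show ?thesis
    by (rule Bochner_Integration.integrable_bound[OF integrable_mult_right[OF discount_integrable, of B]])
       (use discounted_reward_measurable[OF assms] discounted_reward_le[OF assms _ B] B
         in \<open>auto simp: abs_mult\<close>)
qed

lemma ret_eq: "ret S x u = integral\<^sup>L (time_measure S) (discounted_reward x u)"
  by (simp add: ret_def discounted_reward_def[abs_def])

section \<open>Penalized and constrained values\<close>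

text \<open>A real \<open>SUP\<close> or \<open>INF\<close> is informative only over a bounded
  family, so this bound, uniform in state and controller, backs the comparisons with values. The
  case \<open>p = 0\<close> bounds the plain return.\<close>

lemma penalized_return_bound:
  obtains B where "\<And>x u. u \<in> controllers S \<Longrightarrow> x \<in> states S \<Longrightarrow> \<bar>penalized_return p x u\<bar> \<le> B"
proof -
  obtain B where B: "0 \<le> B" "\<And>x a. x \<in> states S \<Longrightarrow> a \<in> controls S \<Longrightarrow> \<bar>reward S x a\<bar> \<le> B"
    using reward_bound by blast
  have "\<bar>penalized_return p x u\<bar> \<le> B * (\<integral>t. exp (- t / tau S) \<partial>time_measure S) + \<bar>p\<bar>"
    if u: "u \<in> controllers S" and x: "x \<in> states S" for x u
  proof -
    have "\<bar>ret S x u\<bar> \<le> (\<integral>t. B * exp (- t / tau S) \<partial>time_measure S)"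
      unfolding ret_eq
      by (rule integral_abs_bound_integral[OF discounted_reward_integrable[OF u x]
            integrable_mult_right[OF discount_integrable] discounted_reward_le[OF u x _ B]])
    moreover have "\<bar>p * risk S x u\<bar> \<le> \<bar>p\<bar> * 1"
      unfolding abs_mult using risk_bounds[OF u x] by (intro mult_left_mono) auto
    ultimately show ?thesis by (simp add: penalized_return_def)
  qed
  then show ?thesis using that by blast
qed

lemma penalized_value_eq: "penalized_value S p x = (SUP u\<in>controllers S. penalized_return p x u)"
  by (simp add: penalized_value_def penalized_return_def)

lemma penalized_return_le_value:
  assumes "u \<in> controllers S" "x \<in> states S"
  shows "penalized_return p x u \<le> penalized_value S p x"
proof -
  obtain B where "\<And>x u. u \<in> controllers S \<Longrightarrow> x \<in> states S \<Longrightarrow> \<bar>penalized_return p x u\<bar> \<le> B"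
    using penalized_return_bound by blast
  then show ?thesis
    unfolding penalized_value_eq using assms
    by (intro cSUP_upper bdd_aboveI2[where M = B]) (auto simp: abs_le_iff)
qed

lemma ret_le_penalized_value:
  assumes "u \<in> safe_controllers S" "x \<in> viable S"
  shows "ret S x u \<le> penalized_value S p x"
  using penalized_return_le_value[of u x p] assms viable_subset
  by (auto simp: safe_controllers_def penalized_return_def risk_safe)

lemma constrained_le_penalized_value:
  assumes "x \<in> viable S"
  shows "constrained_value S x \<le> penalized_value S p x"
  unfolding constrained_value_def
  using assms by (intro cSUP_least safe_controllers_nonempty ret_le_penalized_value)

lemma inf_V_le_penalized_value:
  assumes x: "x \<in> viable S"
  shows "inf_V S \<le> penalized_value S p x"
proof -
  obtain B where B: "\<And>x u. u \<in> controllers S \<Longrightarrow> x \<in> states S \<Longrightarrow> \<bar>penalized_return 0 x u\<bar> \<le> B"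
    using penalized_return_bound by blast
  obtain u where u: "u \<in> safe_controllers S" using safe_controllers_nonempty by blast
  \<comment> \<open>Boundedness below of the constrained values, without which their infimum need
    not be a lower bound.\<close>
  have "- B \<le> constrained_value S y" if y: "y \<in> viable S" for y
  proof -
    have "bdd_above ((\<lambda>u. ret S y u) ` safe_controllers S)"
      using ret_le_penalized_value[OF _ y, of _ 0] by (intro bdd_aboveI2)
    then have "ret S y u \<le> constrained_value S y"
      unfolding constrained_value_def using u by (intro cSUP_upper)
    moreover have "- B \<le> ret S y u"
      using B[OF subsetD[OF safe_subset u] subsetD[OF viable_subset y]]
      by (simp add: penalized_return_def abs_le_iff)
    ultimately show ?thesis by simp
  qed
  then have "inf_V S \<le> constrained_value S x"
    unfolding inf_V_def using x by (intro cINF_lower bdd_belowI2)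
  then show ?thesis using constrained_le_penalized_value[OF x, of p] by simp
qed

lemma optimal_penalized_return:
  assumes "optimal_penalized S p u" "x \<in> states S"
  shows "penalized_return p x u = penalized_value S p x"
  using assms by (simp add: optimal_penalized_def penalized_return_def)

lemma optimal_constrainedI:
  assumes opt: "optimal_penalized S p u" and u: "u \<in> safe_controllers S"
  shows "optimal_constrained S u"
  unfolding optimal_constrained_def
proof (intro conjI ballI u)
  fix v assume v: "v \<in> safe_controllers S"
  interpret prob_space "init S" using standing by (simp add: standing_assumptions_def)
  have AE: "AE x in init S. x \<in> viable S" using standing by (simp add: standing_assumptions_def)
  obtain B where B: "\<And>x u. u \<in> controllers S \<Longrightarrow> x \<in> states S \<Longrightarrow> \<bar>penalized_return 0 x u\<bar> \<le> B"
    using penalized_return_bound by blast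
  have int: "integrable (init S) (\<lambda>x. ret S x w)" if w: "w \<in> safe_controllers S" for w
  proof (rule integrable_const_bound)
    show "AE x in init S. norm (ret S x w) \<le> B"
      using AE by eventually_elim
        (use w safe_subset viable_subset B[of w] in \<open>auto simp: penalized_return_def\<close>)
    show "(\<lambda>x. ret S x w) \<in> borel_measurable (init S)"
      using w standing by (simp add: standing_assumptions_def)
  qed
  have "ret S x v \<le> ret S x u" if x: "x \<in> viable S" for x
    using ret_le_penalized_value[OF v x, of p] optimal_penalized_return[OF opt, of x] u x viable_subset
    by (auto simp: penalized_return_def safe_controllers_def risk_safe)
  then have "AE x in init S. ret S x v \<le> ret S x u" using AE by auto
  then show "(\<integral>x. ret S x v \<partial>init S) \<le> (\<integral>x. ret S x u \<partial>init S)"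
    using int u v by (intro integral_mono_AE)
qed

section \<open>Restarting along a trajectory\<close>

text \<open>By the bound on \<open>t\<close>, every failing instant \<open>r\<close> of the original
  trajectory satisfies \<open>t \<le> r\<close>, so \<open>r - t\<close> is again a time and failing
  instants correspond under translation by \<open>t\<close>.\<close>

lemma failure_time_shift:
  assumes u: "u \<in> controllers S" and x: "x \<in> states S" and t: "t \<in> times S"
    and le: "ereal t \<le> failure_time S x u"
  shows "ereal s \<le> failure_time S (flow S u x t) u \<longleftrightarrow> ereal (t + s) \<le> failure_time S x u"
proof -
  have *: "t \<le> r" if "r \<in> times S" "flow S u x r \<in> failure S" for r
    using le that by (auto simp: le_failure_time_iff)
  show ?thesis
    unfolding le_failure_time_iff
  proof safe
    fix r assume r: "r \<in> times S" "flow S u x r \<in> failure S"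
      and H: "\<forall>r\<in>times S. flow S u (flow S u x t) r \<in> failure S \<longrightarrow> s \<le> r"
    have d: "r - t \<in> times S" using *[OF r] r t time_diff by blast
    then have "flow S u (flow S u x t) (r - t) \<in> failure S"
      using flow_add[OF u x t d] r by simp
    then show "t + s \<le> r" using H d by force
  next
    fix r assume r: "r \<in> times S" "flow S u (flow S u x t) r \<in> failure S"
      and H: "\<forall>r\<in>times S. flow S u x r \<in> failure S \<longrightarrow> t + s \<le> r"
    then show "s \<le> r" using flow_add[OF u x t r(1)] time_add[OF t r(1)] by force
  qed
qed

lemma risk_shift:
  assumes u: "u \<in> controllers S" and x: "x \<in> states S" and t: "t \<in> times S"
    and le: "ereal t \<le> failure_time S x u"
  shows "risk S x u = exp (- t / tau S) * risk S (flow S u x t) u"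
  using u x
proof (cases rule: failure_time_cases)
  case safe
  then have "safe_for S (flow S u x t) u"
    using flow_add[OF u x t] time_add[OF t] by (auto simp: safe_for_def)
  then show ?thesis using safe by (simp add: risk_safe)
next
  case (fails r)
  have tr: "t \<le> r" using le fails by simp
  have d: "r - t \<in> times S" using time_diff tr t fails by blast
  have "failure_time S (flow S u x t) u = ereal (r - t)"
  proof (rule failure_time_eqI[OF d])
    show "flow S u (flow S u x t) (r - t) \<in> failure S"
      using flow_add[OF u x t d] fails by simp
    show "flow S u (flow S u x t) s \<notin> failure S" if "s \<in> times S" "s < r - t" for s
      using flow_add[OF u x t that(1)] fails(3)[of "t + s"] time_add t that by auto
  qed
  then show ?thesis using fails by (simp add: risk_def mult_exp_exp diff_divide_distrib)
qed

text \<open>The dynamic programming identity for a fixed controller. It includes the failure time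
  itself, as the sink is entered only afterwards; restarting later would begin again from a failed
  state of \<open>flow\<close>, with its own reward and penalty.\<close>

lemma penalized_return_split:
  assumes u: "u \<in> controllers S" and x: "x \<in> states S" and t: "t \<in> times S"
    and le: "ereal t \<le> failure_time S x u"
  shows "penalized_return p x u =
    (\<integral>s. indicator {..<t} s * discounted_reward x u s \<partial>time_measure S)
    + exp (- t / tau S) * penalized_return p (flow S u x t) u"
proof -
  have "discounted_reward x u (t + s) = exp (- t / tau S) * discounted_reward (flow S u x t) u s"
    if "s \<in> times S" for s
    using failure_time_shift[OF u x t le, of s] flow_add[OF u x t that]
    by (simp add: discounted_reward_def sink_reward_def sink_flow_def mult_exp_exp
        diff_divide_distrib add_divide_distrib)
  then have "(\<integral>s. discounted_reward x u (t + s) \<partial>time_measure S) =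
      (\<integral>s. exp (- t / tau S) * discounted_reward (flow S u x t) u s \<partial>time_measure S)"
    by (intro Bochner_Integration.integral_cong) auto
  also have "\<dots> = exp (- t / tau S) * ret S (flow S u x t) u"
    by (simp add: ret_eq)
  finally show ?thesis
    using integral_split[OF discounted_reward_integrable[OF u x] t] risk_shift[OF u x t le]
    by (simp add: penalized_return_def ret_eq algebra_simps)
qed

section \<open>Upper bounds on unviable states\<close>

lemma reward_le_R_unviable:
  assumes "x \<in> unviable S" "a \<in> controls S"
  shows "reward S x a \<le> R_unviable S"
proof -
  obtain B where "0 \<le> B" and B: "\<And>x a. x \<in> states S \<Longrightarrow> a \<in> controls S \<Longrightarrow> \<bar>reward S x a\<bar> \<le> B"
    using reward_bound by blast
  have "(\<lambda>(x, a). reward S x a) (x, a) \<le> R_unviable S"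
    unfolding R_unviable_def
    using assms unviable_subset B by (intro cSUP_upper bdd_aboveI2[where M = B]) (auto simp: abs_le_iff)
  then show ?thesis by simp
qed

lemma penalized_return_unviable_le:
  assumes x: "x \<in> unviable S" and u: "u \<in> controllers S" and ft: "failure_time S x u = ereal t"
  shows "penalized_return p x u \<le> R_unviable S * discount_upto t - p * exp (- t / tau S)"
proof -
  have xs: "x \<in> states S" using x unviable_subset by blast
  have "integrable (time_measure S) (\<lambda>s. indicator {..t} s * exp (- s / tau S))"
    by (rule Bochner_Integration.integrable_bound[OF discount_integrable])
       (use time_measurable in \<open>auto simp: indicator_def\<close>)
  \<comment> \<open>Up to \<open>t\<close> the trajectory is still unviable, so
    \<open>R_unviable\<close> bounds the reward; after \<open>t\<close> the sink makes the left side
    0 and the indicator the right side.\<close>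
  moreover have "discounted_reward x u s \<le> R_unviable S * (indicator {..t} s * exp (- s / tau S))"
    if s: "s \<in> times S" for s
    using reward_le_R_unviable[OF unviable_flow[OF x u s] control_in[OF u flow_states[OF u xs s]]]
    by (auto simp: discounted_reward_def sink_flow_def sink_reward_def ft mult.commute)
  ultimately have "ret S x u \<le> (\<integral>s. R_unviable S * (indicator {..t} s * exp (- s / tau S)) \<partial>time_measure S)"
    unfolding ret_eq
    by (intro integral_mono discounted_reward_integrable[OF u xs] integrable_mult_right) auto
  also have "\<dots> = R_unviable S * discount_upto t"
    unfolding discount_upto_def by simp
  finally show ?thesis by (simp add: penalized_return_def risk_def ft)
qed

lemma penalized_value_le_sup_V_pen:
  assumes "x \<in> unviable S"
  shows "penalized_value S p x \<le> sup_V_pen S p"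
proof -
  obtain B where "\<And>x u. u \<in> controllers S \<Longrightarrow> x \<in> states S \<Longrightarrow> \<bar>penalized_return p x u\<bar> \<le> B"
    using penalized_return_bound by blast
  then have "penalized_value S p y \<le> B" if "y \<in> unviable S" for y
    unfolding penalized_value_eq using controllers_nonempty that unviable_subset
    by (intro cSUP_least) (auto simp: abs_le_iff)
  then show ?thesis
    unfolding sup_V_pen_def using assms by (intro cSUP_upper bdd_aboveI2)
qed

text \<open>With \<open>q = exp (- t / tau S)\<close>, the bound on the penalized return of a state failing at time \<open>t\<close>
  is affine in \<open>q\<close>, so it suffices to control it at both ends of the range of \<open>q\<close>.\<close>

lemma sup_V_pen_less:
  assumes ft: "\<And>x u. x \<in> unviable S \<Longrightarrow> u \<in> controllers S \<Longrightarrow> failure_time S x u \<le> ereal T"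
    and upto: "\<And>t. t \<in> times S \<Longrightarrow> discount_upto t = \<alpha> - \<beta> * exp (- t / tau S)"
    and p0: "R_unviable S * \<alpha> - c - R_unviable S * \<beta> < p"
    and pT: "(R_unviable S * \<alpha> - c) / exp (- T / tau S) - R_unviable S * \<beta> < p"
  shows "sup_V_pen S p < c"
proof -
  let ?R = "R_unviable S" and ?q = "exp (- T / tau S)"
  \<comment> \<open>The two entries are the bound
    \<open>?R * \<alpha> - (?R * \<beta> + p) * q\<close> at \<open>q = 1\<close>, immediate
    failure, and at \<open>q = ?q\<close>, failure at \<open>T\<close>. \<open>p0\<close> and
    \<open>pT\<close> place one entry each below \<open>c\<close>.\<close>
  define m where "m = max (?R * \<alpha> - (?R * \<beta> + p)) (?R * \<alpha> - (?R * \<beta> + p) * ?q)"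
  have "penalized_return p x u \<le> m" if x: "x \<in> unviable S" and u: "u \<in> controllers S" for x u
    using u subsetD[OF unviable_subset x]
  proof (cases rule: failure_time_cases)
    case (fails t)
    then have "t \<le> T" using ft[OF x u] by simp
    then have "?q \<le> exp (- t / tau S)" "exp (- t / tau S) \<le> 1"
      using tau_pos time_nonneg[OF fails(1)] by (auto simp: divide_right_mono)
    from affine_le_max_endpoints[OF this] have "?R * \<alpha> - (?R * \<beta> + p) * exp (- t / tau S) \<le> m"
      by (simp add: m_def)
    then show ?thesis
      using penalized_return_unviable_le[OF x u fails(4), of p] upto[OF fails(1)] by (simp add: algebra_simps)
  qed (use ft[OF x u] in auto)
  then have "penalized_value S p x \<le> m" if "x \<in> unviable S" for x
    unfolding penalized_value_eq using that controllers_nonempty by (intro cSUP_least)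
  then have "sup_V_pen S p \<le> m"
    unfolding sup_V_pen_def using unviable_nonempty by (intro cSUP_least)
  also have "m < c"
  proof -
    have "?R * \<alpha> - c < (?R * \<beta> + p) * ?q" using pT by (simp add: field_simps)
    then show ?thesis using p0 by (simp add: m_def)
  qed
  finally show ?thesis .
qed

text \<open>Only safety has to be checked: an optimal controller that is safe is automatically
  optimal for the constrained problem.\<close>

lemma safe_value_functionI:
  assumes "\<And>u x t. optimal_penalized S p u \<Longrightarrow> x \<in> viable S \<Longrightarrow> t \<in> times S \<Longrightarrow>
    flow S u x t \<notin> failure S"
  shows "safe_value_function S p"
  unfolding safe_value_function_def
proof (intro allI impI)
  fix u assume opt: "optimal_penalized S p u"
  then have "u \<in> safe_controllers S"
    using assms by (auto simp: safe_controllers_def safe_for_def optimal_penalized_def)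
  then show "u \<in> safe_controllers S \<and> optimal_constrained S u"
    using optimal_constrainedI[OF opt] by blast
qed

end

section \<open>Continuous time\<close>

text \<open>The integral equation is autonomous: splitting the integral over
  \<open>{0..s + t}\<close> at \<open>s\<close> and translating the second piece gives the equation
  started at \<open>\<xi> s\<close>.\<close>

lemma ct_trajectory_shift:
  fixes S :: "('x::euclidean_space, 'u) control_problem"
  assumes traj: "ct_trajectory S u x \<xi>" and s: "0 \<le> s"
  shows "ct_trajectory S u (\<xi> s) (\<lambda>t. \<xi> (s + t))"
proof -
  define g where "g = (\<lambda>r. dyn S (\<xi> r) (u (\<xi> r)))"
  have int: "g integrable_on {0..t}" "(\<lambda>r. norm (g r)) integrable_on {0..t}"
    and sol: "\<xi> t = x + integral {0..t} g" if "0 \<le> t" for t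
    using traj that unfolding ct_trajectory_def g_def absolutely_integrable_on_def by auto
  have cont: "continuous_on {0..} \<xi>" and sub: "\<xi> ` {0..} \<subseteq> states S"
    using traj by (auto simp: ct_trajectory_def)
  have "continuous_on {0..} (\<lambda>t. \<xi> (s + t))"
    by (rule continuous_on_compose2[OF cont]) (use s in \<open>auto intro!: continuous_intros\<close>)
  moreover have "(\<lambda>t. \<xi> (s + t)) ` {0..} \<subseteq> states S"
    using sub s by (force simp: image_subset_iff)
  moreover have "(\<lambda>r. g (s + r)) absolutely_integrable_on {0..t}"
    and "\<xi> (s + t) = \<xi> s + integral {0..t} (\<lambda>r. g (s + r))" if t: "0 \<le> t" for t
  proof -
    \<comment> \<open>Stated for an arbitrary Banach-valued \<open>f\<close> so that it applies both
      to \<open>g\<close> and to its norm, the two halves of absolute integrability.\<close>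
    have "f integrable_on {s..s + t}" if "f integrable_on {0..s + t}" for f :: "real \<Rightarrow> 'b::banach"
      by (rule integrable_on_subinterval[OF that]) (use s in auto)
    then have "g integrable_on {s..s + t}" "(\<lambda>r. norm (g r)) integrable_on {s..s + t}"
      using int[of "s + t"] s t by auto
    then show "(\<lambda>r. g (s + r)) absolutely_integrable_on {0..t}"
      using integrable_on_shift_Icc_real[of g s 0 t]
        integrable_on_shift_Icc_real[of "\<lambda>r. norm (g r)" s 0 t]
      by (simp add: absolutely_integrable_on_def o_def add.commute)
    have "integral {0..s} g + integral {s..s + t} g = integral {0..s + t} g"
      using s t int[of "s + t"] by (intro Henstock_Kurzweil_Integration.integral_combine) auto
    then show "\<xi> (s + t) = \<xi> s + integral {0..t} (\<lambda>r. g (s + r))"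
      using sol[of "s + t"] sol[of s] s t integral_shift_Icc_real[of 0 t g s]
      by (simp add: o_def add.commute algebra_simps)
  qed
  ultimately show ?thesis unfolding ct_trajectory_def g_def by simp
qed

text \<open>The equation sees a feedback only through its values along the curve.\<close>

lemma ct_trajectory_cong:
  assumes traj: "ct_trajectory S u x \<xi>" and eq: "\<And>s. 0 \<le> s \<Longrightarrow> u (\<xi> s) = w (\<xi> s)"
  shows "ct_trajectory S w x \<xi>"
proof -
  have "(\<lambda>s. dyn S (\<xi> s) (w (\<xi> s))) absolutely_integrable_on {0..t} \<longleftrightarrow>
        (\<lambda>s. dyn S (\<xi> s) (u (\<xi> s))) absolutely_integrable_on {0..t}"
    and "integral {0..t} (\<lambda>s. dyn S (\<xi> s) (w (\<xi> s))) = integral {0..t} (\<lambda>s. dyn S (\<xi> s) (u (\<xi> s)))" for t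
    using eq by (intro set_integrable_cong integral_cong; simp)+
  then show ?thesis using traj unfolding ct_trajectory_def by metis
qed

text \<open>\<open>g\<close> is extended by zero to the whole line, where translation by
  \<open>t\<close> preserves the integral.\<close>

lemma lebesgue_halfline_split:
  fixes g :: "real \<Rightarrow> real"
  assumes g: "integrable (lebesgue_on {0..}) g" and t: "0 \<le> t"
  shows "integral\<^sup>L (lebesgue_on {0..}) g =
    (\<integral>s. indicator {..<t} s * g s \<partial>lebesgue_on {0..}) + (\<integral>s. g (t + s) \<partial>lebesgue_on {0..})"
proof -
  define G where "G = (\<lambda>s. indicator {0..} s * g s)"
  have G: "integrable lebesgue G"
    using g unfolding G_def by (simp add: integrable_restrict_space)
  have "integral\<^sup>L (lebesgue_on {0..}) g = (\<integral>s. G s \<partial>lebesgue)"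
    unfolding G_def by (simp add: integral_restrict_space)
  also have "\<dots> = (\<integral>s. indicator {..<t} s * G s + indicator {t..} s * G s \<partial>lebesgue)"
    by (intro Bochner_Integration.integral_cong) (auto simp: indicator_def)
  also have "\<dots> = (\<integral>s. indicator {..<t} s * G s \<partial>lebesgue) + (\<integral>s. indicator {t..} s * G s \<partial>lebesgue)"
    using integrable_mult_indicator[OF _ G, of "{..<t}"] integrable_mult_indicator[OF _ G, of "{t..}"]
    by (intro Bochner_Integration.integral_add) auto
  also have "(\<integral>s. indicator {..<t} s * G s \<partial>lebesgue) = (\<integral>s. indicator {..<t} s * g s \<partial>lebesgue_on {0..})"
    unfolding G_def by (simp add: integral_restrict_space mult.left_commute)
  also have "(\<integral>s. indicator {t..} s * G s \<partial>lebesgue) = (\<integral>s. indicator {t..} (t + s) * G (t + s) \<partial>lebesgue)"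
    by (subst lebesgue_integral_real_affine[where c = 1 and t = t]) auto
  also have "\<dots> = (\<integral>s. indicator {0..} s * g (t + s) \<partial>lebesgue)"
    using t by (intro Bochner_Integration.integral_cong) (auto simp: G_def indicator_def)
  also have "\<dots> = (\<integral>s. g (t + s) \<partial>lebesgue_on {0..})"
    by (simp add: integral_restrict_space)
  finally show ?thesis .
qed

text \<open>Both cuts differ by the null set \<open>{t}\<close>. The passage to the gauge integral
  gives access to the continuity of indefinite integrals.\<close>

lemma lebesgue_halfline_upto:
  fixes g :: "real \<Rightarrow> real"
  assumes g: "integrable (lebesgue_on {0..}) g" and t: "0 \<le> t" and A: "A = {..t} \<or> A = {..<t}"
  shows "(\<integral>s. indicator A s * g s \<partial>lebesgue_on {0..}) = integral {0..t} g"
proof -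
  have "A \<inter> {0..} \<in> sets (lebesgue_on {0..})"
    using A by (subst sets_restrict_space_iff) auto
  then have "integrable (lebesgue_on {0..}) (\<lambda>s. indicator (A \<inter> {0..}) s *\<^sub>R g s)"
    using g by (rule integrable_mult_indicator)
  then have "integrable (lebesgue_on {0..}) (\<lambda>s. indicator A s * g s)"
    by (rule Bochner_Integration.integrable_cong[THEN iffD1, rotated 2]) (auto simp: indicator_def)
  then have "(\<integral>s. indicator A s * g s \<partial>lebesgue_on {0..}) = integral {0..} (\<lambda>s. indicator A s * g s)"
    by (rule lebesgue_integral_eq_integral) simp
  also have "\<dots> = integral {0..} (\<lambda>s. if s \<in> {..t} then g s else 0)"
    by (rule integral_spike[of "{t}"]) (use A in \<open>auto simp: indicator_def\<close>)
  also have "\<dots> = integral ({..t} \<inter> {0..}) g"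
    by (rule integral_restrict_Int)
  also have "{..t} \<inter> {0..} = {0..t}" by auto
  finally show ?thesis .
qed

lemma has_bochner_integral_exp_halfline:
  assumes "0 < (c::real)"
  shows "has_bochner_integral (lebesgue_on {0..}) (\<lambda>t. exp (- t / c)) c"
proof -
  have I: "((\<lambda>t. exp (- t / c)) has_integral c) {0..}"
    using has_integral_exp_minus_to_infinity[of "1 / c" 0] assms by simp
  then have "(\<lambda>t. exp (- t / c)) absolutely_integrable_on {0..}"
    by (intro nonnegative_absolutely_integrable_1) auto
  then have "integrable (lebesgue_on {0..}) (\<lambda>t. exp (- t / c))"
    by (rule absolutely_integrable_imp_integrable) simp
  then show ?thesis
    using lebesgue_integral_eq_integral[of "{0..}" "\<lambda>t. exp (- t / c)"] I
    by (simp add: has_bochner_integral_iff integral_unique)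
qed

text \<open>The semigroup law and \<open>flow_cong\<close> both come from uniqueness: a shifted
  trajectory, or one along which two feedbacks agree, solves the equation of the flow it is compared
  with.\<close>

lemma ct_controlled_flow:
  fixes S :: "('x::euclidean_space, 'u::euclidean_space) control_problem"
  assumes ct: "ct_dynamics S" and st: "standing_assumptions S"
  shows "controlled_flow S"
proof -
  have M: "time_measure S = lebesgue_on {0..}" using ct by (simp add: ct_dynamics_def)
  then have T: "times S = {0..}" by simp
  have traj: "ct_trajectory S u x (flow S u x)" if "u \<in> controllers S" "x \<in> states S" for u x
    using ct that by (simp add: ct_dynamics_def)
  have uniq: "\<xi> t = flow S u x t"
    if "u \<in> controllers S" "x \<in> states S" "ct_trajectory S u x \<xi>" "0 \<le> t" for u x \<xi> t
    using ct that by (simp add: ct_dynamics_def)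
  have cont: "continuous_on {0..} (flow S u x)" and sub: "flow S u x ` {0..} \<subseteq> states S"
    if "u \<in> controllers S" "x \<in> states S" for u x
    using traj[OF that] by (auto simp: ct_trajectory_def)
  show ?thesis
  proof (unfold_locales)
    show "standing_assumptions S" by (rule st)
    show "(\<lambda>t. t) \<in> borel_measurable (time_measure S)"
      unfolding M using id_borel_measurable_lebesgue_on by (simp add: id_def)
    show "integrable (time_measure S) (\<lambda>t. exp (- t / tau S))"
      unfolding M using has_bochner_integral_exp_halfline[of "tau S"] st
      by (auto simp: has_bochner_integral_iff standing_assumptions_def)
    show "integral\<^sup>L (time_measure S) g =
        (\<integral>s. indicator {..<t} s * g s \<partial>time_measure S) + (\<integral>s. g (t + s) \<partial>time_measure S)"
      if "integrable (time_measure S) g" "t \<in> times S" for g :: "real \<Rightarrow> real" and t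
      using that unfolding M by (intro lebesgue_halfline_split) auto
  next
    fix u x assume u: "u \<in> controllers S" and x: "x \<in> states S"
    show "flow S u x 0 = x" using traj[OF u x] by (auto simp: ct_trajectory_def dest: spec[of _ 0])
    show st': "flow S u x t \<in> states S" if "t \<in> times S" for t
      using sub[OF u x] that T by auto
    show "flow S u (flow S u x s) t = flow S u x (s + t)" if "s \<in> times S" "t \<in> times S" for s t
    proof -
      have "ct_trajectory S u (flow S u x s) (\<lambda>t. flow S u x (s + t))"
        using that T by (intro ct_trajectory_shift[OF traj[OF u x]]) auto
      from uniq[OF u st'[OF that(1)] this, of t] show ?thesis using that T by simp
    qed
    show "flow S w x t = flow S u x t" if "w \<in> controllers S"
      "\<And>s. s \<in> times S \<Longrightarrow> u (flow S u x s) = w (flow S u x s)" "t \<in> times S" for w t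
    proof -
      have "ct_trajectory S w x (flow S u x)"
        by (rule ct_trajectory_cong[OF traj[OF u x]]) (use that T in auto)
      from uniq[OF that(1) x this, of t] show ?thesis using that T by simp
    qed
    \<comment> \<open>The orbit is a countable union of continuous images of compact intervals,
      hence Borel.\<close>
    have "flow S u x ` times S = (\<Union>n::nat. flow S u x ` {0..real n})"
      unfolding T by (auto simp: image_iff) (metis atLeastAtMost_iff real_arch_simple)
    also have "\<dots> \<in> sets borel"
      by (intro sets.countable_UN image_subsetI borel_compact compact_continuous_image
          continuous_on_subset[OF cont[OF u x]]) auto
    finally show "flow S u x ` times S \<in> sets borel" .
    show "(\<lambda>t. reward S (flow S u x t) (u (flow S u x t))) \<in> borel_measurable (time_measure S)"
    proof -
      have f: "flow S u x \<in> lebesgue_on {0..} \<rightarrow>\<^sub>M restrict_space borel (states S)"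
        using sub[OF u x] continuous_imp_measurable_on_sets_lebesgue[OF cont[OF u x]]
        by (intro measurable_restrict_space2) auto
      then have a: "(\<lambda>t. u (flow S u x t)) \<in> lebesgue_on {0..} \<rightarrow>\<^sub>M restrict_space borel (controls S)"
        using u unfolding controllers_def by (rule measurable_compose)
      have pair: "(\<lambda>t. (flow S u x t, u (flow S u x t))) \<in>
          lebesgue_on {0..} \<rightarrow>\<^sub>M restrict_space borel (states S \<times> controls S)"
        using f a unfolding measurable_restrict_space2_iff by (auto intro!: borel_measurable_Pair)
      have "(\<lambda>(x, a). reward S x a) \<in>
          borel_measurable (restrict_space borel (states S \<times> controls S))"
        using st by (simp add: standing_assumptions_def)
      from measurable_compose[OF pair this] show ?thesis by (simp add: M)
    qed
    show "\<exists>t\<in>times S. flow S u x t \<in> failure S \<and>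
        (\<forall>s\<in>times S. s < t \<longrightarrow> flow S u x s \<notin> failure S)"
      if t: "t \<in> times S" "flow S u x t \<in> failure S" for t
    proof -
      \<comment> \<open>The failure set is closed only relative to \<open>states S\<close>; since
        the trajectory stays there, its preimage \<open>A\<close> is closed and contains its
        infimum.\<close>
      define A where "A = {0..} \<inter> flow S u x -` failure S"
      have "closedin (top_of_set (states S)) (failure S)"
        using st by (simp add: standing_assumptions_def)
      then have "closedin (top_of_set {0..}) A"
        unfolding A_def using cont[OF u x] sub[OF u x]
        by (intro continuous_closedin_preimage_gen) auto
      then have "closed A" by (simp add: closedin_closed_eq)
      moreover have "A \<noteq> {}" using t T by (auto simp: A_def)
      moreover have bdd: "bdd_below A" by (rule bdd_belowI[of _ 0]) (auto simp: A_def)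
      ultimately have "Inf A \<in> A" using closed_contains_Inf by blast
      moreover have "s \<notin> A" if "s < Inf A" for s
        using cInf_lower[OF _ bdd, of s] that by auto
      ultimately show ?thesis unfolding T A_def by blast
    qed
  qed (auto simp: T)
qed

text \<open>Along the trajectory of an optimal controller the penalized value is continuous up to failure,
  hence cannot jump over the gap between its values on unviable and on viable states.\<close>

lemma ct_safe_value_function:
  fixes S :: "('x::euclidean_space, 'u::euclidean_space) control_problem"
  assumes ct: "ct_dynamics S" and st: "standing_assumptions S"
    and gap: "sup_V_pen S p < inf_V S"
  shows "safe_value_function S p"
proof -
  interpret controlled_flow S using ct st by (rule ct_controlled_flow)
  have M: "time_measure S = lebesgue_on {0..}" using ct by (simp add: ct_dynamics_def)
  then have T: "times S = {0..}" by simp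
  show ?thesis
  proof (rule safe_value_functionI, rule notI)
    fix u x t
    assume opt: "optimal_penalized S p u" and xv: "x \<in> viable S"
      and t: "t \<in> times S" "flow S u x t \<in> failure S"
    have u: "u \<in> controllers S" using opt by (simp add: optimal_penalized_def)
    have x: "x \<in> states S" using xv viable_subset by blast
    obtain r where r: "r \<in> times S" "flow S u x r \<in> failure S" and ft: "failure_time S x u = ereal r"
      using failure_time_cases[OF u x] t unfolding safe_for_def by metis
    \<comment> \<open>\<open>penalized_return_split\<close> solved for the return from
      \<open>flow S u x s\<close>. In this form continuity in \<open>s\<close> follows from that of
      the indefinite integral, and no regularity of the value in the state is involved.\<close>
    define \<Phi> where "\<Phi> = (\<lambda>s. exp (s / tau S) *
      (penalized_return p x u - integral {0..s} (discounted_reward x u)))"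
    have int: "integrable (lebesgue_on {0..}) (discounted_reward x u)"
      using discounted_reward_integrable[OF u x] by (simp add: M)
    have \<Phi>: "\<Phi> s = penalized_value S p (flow S u x s)" if s: "0 \<le> s" "s \<le> r" for s
    proof -
      have "exp (s / tau S) * (exp (- s / tau S) * penalized_return p (flow S u x s) u) =
          penalized_return p (flow S u x s) u"
        by (simp add: mult.assoc[symmetric] mult_exp_exp)
      then show ?thesis
        using penalized_return_split[OF u x, of s p] s ft T lebesgue_halfline_upto[OF int, of s "{..<s}"]
          optimal_penalized_return[OF opt flow_states[OF u x, of s]]
        by (simp add: \<Phi>_def M)
    qed
    have "(discounted_reward x u) integrable_on {0..}"
      using integrable_on_lebesgue_on[OF int] by simp
    then have "(discounted_reward x u) integrable_on {0..r}"
      by (rule integrable_on_subinterval) auto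
    then have "continuous_on {0..r} \<Phi>"
      unfolding \<Phi>_def using tau_pos by (intro continuous_intros indefinite_integral_continuous_1) auto
    \<comment> \<open>The midpoint of the gap: the failed state at \<open>r\<close> has value below
      it, the viable state at 0 above it, and neither a viable nor an unviable state can have
      exactly this value.\<close>
    moreover define y where "y = (sup_V_pen S p + inf_V S) / 2"
    have "\<Phi> r \<le> y"
      using \<Phi>[of r] r T penalized_value_le_sup_V_pen[of "flow S u x r" p] failure_unviable gap
      by (auto simp: y_def)
    moreover have "y \<le> \<Phi> 0"
      using \<Phi>[of 0] r T flow_zero[OF u x] inf_V_le_penalized_value[OF xv, of p] gap by (auto simp: y_def)
    ultimately obtain s where s: "0 \<le> s" "s \<le> r" "\<Phi> s = y"
      using IVT2'[of \<Phi> r y 0] r T by auto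
    have "flow S u x s \<in> viable S \<or> flow S u x s \<in> unviable S"
      using flow_states[OF u x, of s] s T by (auto simp: unviable_def)
    then show False
      using \<Phi>[OF s(1,2)] s(3) gap penalized_value_le_sup_V_pen[of "flow S u x s" p]
        inf_V_le_penalized_value[of "flow S u x s" p]
      by (auto simp: y_def)
  qed
qed

section \<open>Discrete time\<close>

lemma bij_betw_real_Nats: "bij_betw real UNIV \<nat>"
  by (auto simp: bij_betw_def Nats_def inj_on_def)

lemma integrable_count_space_Nats_iff:
  fixes g :: "real \<Rightarrow> real"
  shows "integrable (count_space \<nat>) g \<longleftrightarrow> summable (\<lambda>n. \<bar>g (real n)\<bar>)"
  using integrable_bij_count_space[OF bij_betw_real_Nats, of g]
  by (simp add: integrable_count_space_nat_iff)

lemma integral_count_space_Nats: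
  fixes g :: "real \<Rightarrow> real"
  assumes "integrable (count_space \<nat>) g"
  shows "integral\<^sup>L (count_space \<nat>) g = (\<Sum>n. g (real n))"
  using integral_bij_count_space[OF bij_betw_real_Nats, of g]
    integrable_bij_count_space[OF bij_betw_real_Nats, of g] assms
  by (simp add: integral_count_space_nat)

lemma integral_count_space_Nats_below:
  fixes g :: "real \<Rightarrow> real"
  shows "(\<integral>s. indicator {..<real k} s * g s \<partial>count_space \<nat>) = (\<Sum>n<k. g (real n))"
proof -
  have "integrable (count_space \<nat>) (\<lambda>s. indicator {..<real k} s * g s)"
    unfolding integrable_count_space_Nats_iff
    by (rule summable_finite[of "{..<k}"]) (auto simp: indicator_def)
  then have "(\<integral>s. indicator {..<real k} s * g s \<partial>count_space \<nat>) =
      (\<Sum>n. indicator {..<real k} (real n) * g (real n))"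
    by (rule integral_count_space_Nats)
  also have "\<dots> = (\<Sum>n<k. indicator {..<real k} (real n) * g (real n))"
    by (rule suminf_finite) (auto simp: indicator_def)
  also have "\<dots> = (\<Sum>n<k. g (real n))" by (intro sum.cong) auto
  finally show ?thesis .
qed

lemma count_space_Nats_split:
  fixes g :: "real \<Rightarrow> real"
  assumes g: "integrable (count_space \<nat>) g"
  shows "integral\<^sup>L (count_space \<nat>) g =
    (\<integral>s. indicator {..<real k} s * g s \<partial>count_space \<nat>) + (\<integral>s. g (real k + s) \<partial>count_space \<nat>)"
proof -
  have abs: "summable (\<lambda>n. \<bar>g (real n)\<bar>)" using g by (simp add: integrable_count_space_Nats_iff)
  have "summable (\<lambda>n. \<bar>g (real k + real n)\<bar>)"
    using summable_ignore_initial_segment[OF abs, of k] by (simp add: add.commute)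
  then have "(\<integral>s. g (real k + s) \<partial>count_space \<nat>) = (\<Sum>n. g (real k + real n))"
    by (intro integral_count_space_Nats) (simp add: integrable_count_space_Nats_iff)
  then show ?thesis
    using suminf_split_initial_segment[OF summable_rabs_cancel[OF abs], of k]
    by (simp add: integral_count_space_Nats[OF g] integral_count_space_Nats_below add.commute)
qed

lemma gamma_bounds: "0 < tau S \<Longrightarrow> 0 < gamma S \<and> gamma S < 1"
  by (simp add: gamma_def)

lemma exp_eq_gamma_power: "exp (- real n / tau S) = gamma S ^ n"
  unfolding gamma_def exp_of_nat_mult[symmetric] by simp

lemma dt_controlled_flow:
  fixes S :: "('x::t1_space, 'u::topological_space) control_problem"
  assumes dt: "dt_dynamics S" and st: "standing_assumptions S"
  shows "controlled_flow S"
proof -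
  have M: "time_measure S = count_space \<nat>" using dt by (simp add: dt_dynamics_def)
  then have T: "times S = \<nat>" by simp
  have zero: "flow S u x 0 = x"
    and step: "flow S u x (real (Suc k)) = dyn S (flow S u x (real k)) (u (flow S u x (real k)))"
    if "u \<in> controllers S" "x \<in> states S" for u x k
    using dt that unfolding dt_dynamics_def by blast+
  have sts: "flow S u x (real k) \<in> states S" if u: "u \<in> controllers S" and x: "x \<in> states S" for u x k
  proof (induction k)
    case 0
    then show ?case using zero[OF u x] x by simp
  next
    case (Suc k)
    have "u (flow S u x (real k)) \<in> controls S"
      using measurable_space[OF u[unfolded controllers_def], of "flow S u x (real k)"] Suc
      by (auto simp: space_restrict_space)
    then show ?case unfolding step[OF u x] using dt Suc by (simp add: dt_dynamics_def)
  qed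
  show ?thesis
  proof (unfold_locales)
    show "standing_assumptions S" by (rule st)
    show "integrable (time_measure S) (\<lambda>t. exp (- t / tau S))"
      unfolding M integrable_count_space_Nats_iff exp_eq_gamma_power
      using gamma_bounds[of S] st
      by (auto simp: standing_assumptions_def power_abs intro!: summable_geometric)
    show "integral\<^sup>L (time_measure S) g =
        (\<integral>s. indicator {..<t} s * g s \<partial>time_measure S) + (\<integral>s. g (t + s) \<partial>time_measure S)"
      if "integrable (time_measure S) g" "t \<in> times S" for g :: "real \<Rightarrow> real" and t
      using that count_space_Nats_split unfolding M by (auto simp: Nats_def)
    show "t - s \<in> times S" if "s \<in> times S" "t \<in> times S" "s \<le> t" for s t
      using that Nats_diff by (auto simp: T)
  next
    fix u x assume u: "u \<in> controllers S" and x: "x \<in> states S"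
    show "flow S u x 0 = x" using zero[OF u x] .
    show "flow S u x t \<in> states S" if "t \<in> times S" for t
      using sts[OF u x] that T by (auto simp: Nats_def)
    have "flow S u (flow S u x (real j)) (real k) = flow S u x (real (j + k))" for j k
      by (induction k) (auto simp: zero[OF u sts[OF u x]] step[OF u x] step[OF u sts[OF u x]]
          simp del: of_nat_Suc of_nat_add)
    then show "flow S u (flow S u x s) t = flow S u x (s + t)" if "s \<in> times S" "t \<in> times S" for s t
      using that T by (auto simp: Nats_def)
    show "flow S w x t = flow S u x t" if w: "w \<in> controllers S"
      "\<And>s. s \<in> times S \<Longrightarrow> u (flow S u x s) = w (flow S u x s)" "t \<in> times S" for w t
    proof -
      have "flow S w x (real k) = flow S u x (real k)" for k
        by (induction k) (auto simp: zero[OF u x] zero[OF w(1) x] step[OF u x] step[OF w(1) x] w(2) T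
            simp del: of_nat_Suc)
      then show ?thesis using w(3) T by (auto simp: Nats_def)
    qed
    \<comment> \<open>Points are closed in a T1 space, so a countable orbit is Borel.\<close>
    have "countable (flow S u x ` times S)" unfolding T Nats_def by simp
    then show "flow S u x ` times S \<in> sets borel"
      by (rule sets.countable[rotated]) (simp add: borel_closed)
    show "\<exists>t\<in>times S. flow S u x t \<in> failure S \<and>
        (\<forall>s\<in>times S. s < t \<longrightarrow> flow S u x s \<notin> failure S)"
      if t: "t \<in> times S" "flow S u x t \<in> failure S" for t
    proof -
      obtain n where "t = real n" using t(1) unfolding T by (elim Nats_cases)
      then obtain k where "flow S u x (real k) \<in> failure S" "\<forall>i<k. flow S u x (real i) \<notin> failure S"
        using t(2) exists_least_iff[of "\<lambda>n. flow S u x (real n) \<in> failure S"] by blast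
      then show ?thesis unfolding T by (intro bexI[of _ "real k"]) (auto simp: Nats_def)
    qed
  qed (auto simp: T M elim: Nats_cases)
qed

locale discrete_flow =
  fixes S :: "('x::t1_space, 'u::topological_space) control_problem"
  assumes dt: "dt_dynamics S" and st: "standing_assumptions S"

sublocale discrete_flow \<subseteq> controlled_flow S
  using dt st by (rule dt_controlled_flow)

context discrete_flow
begin

lemma time_measure_eq: "time_measure S = count_space \<nat>"
  using dt by (simp add: dt_dynamics_def)

lemma times_eq: "times S = \<nat>"
  by (simp add: time_measure_eq)

lemma gamma_pos: "0 < gamma S" and gamma_less_one: "gamma S < 1"
  using gamma_bounds[OF tau_pos] by auto

lemma dyn_states: "x \<in> states S \<Longrightarrow> a \<in> controls S \<Longrightarrow> dyn S x a \<in> states S"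
  using dt by (simp add: dt_dynamics_def)

lemma flow_Suc:
  "u \<in> controllers S \<Longrightarrow> x \<in> states S \<Longrightarrow>
    flow S u x (real (Suc k)) = dyn S (flow S u x (real k)) (u (flow S u x (real k)))"
  using dt unfolding dt_dynamics_def by blast

lemma flow_one: "u \<in> controllers S \<Longrightarrow> x \<in> states S \<Longrightarrow> flow S u x 1 = dyn S x (u x)"
  using flow_Suc[of u x 0] flow_zero[of u x] by simp

lemma discounted_reward_zero:
  "u \<in> controllers S \<Longrightarrow> x \<in> states S \<Longrightarrow> discounted_reward x u 0 = reward S x (u x)"
  using flow_zero time_nonneg le_failure_time_iff[of 0 x u]
  by (simp add: discounted_reward_def sink_flow_def sink_reward_def zero_ereal_def)

lemma integral_below_one:
  "(\<integral>s. indicator {..<1} s * discounted_reward x u s \<partial>time_measure S) = discounted_reward x u 0"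
  using integral_count_space_Nats_below[of 1] by (simp add: time_measure_eq)

text \<open>The Bellman equation of a fixed controller: a state outside the failure set fails at
  time 1 at the earliest, so the return may be split there.\<close>

lemma penalized_return_step:
  assumes u: "u \<in> controllers S" and x: "x \<in> states S" "x \<notin> failure S"
  shows "penalized_return p x u = reward S x (u x) + gamma S * penalized_return p (dyn S x (u x)) u"
proof -
  have "ereal 1 \<le> failure_time S x u"
    unfolding le_failure_time_iff times_eq
  proof (intro ballI impI)
    fix t assume "t \<in> \<nat>" "flow S u x t \<in> failure S"
    then show "1 \<le> t" using x flow_zero[OF u x(1)] by (cases "t = 0") (auto simp: Nats_def)
  qed
  moreover have "1 \<in> times S" by (simp add: times_eq)
  ultimately show ?thesis
    using penalized_return_split[OF u x(1), of 1 p]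
    by (simp add: integral_below_one discounted_reward_zero[OF u x(1)] flow_one[OF u x(1)] gamma_def)
qed

text \<open>Failure at time 0 has risk 1, and the sink is reached at time 1, so exactly one reward
  is collected.\<close>

lemma penalized_return_failure:
  assumes u: "u \<in> controllers S" and x: "x \<in> failure S"
  shows "penalized_return p x u = reward S x (u x) - p"
proof -
  have xs: "x \<in> states S" using x failure_subset by blast
  have ft: "failure_time S x u = ereal 0"
    by (rule failure_time_eqI) (use x flow_zero[OF u xs] time_zero time_nonneg in force)+
  have "(\<integral>s. discounted_reward x u (1 + s) \<partial>time_measure S) = (\<integral>s. 0 \<partial>time_measure S)"
    by (rule Bochner_Integration.integral_cong)
       (auto simp: discounted_reward_def sink_flow_def ft sink_reward_def dest!: time_nonneg)
  then show ?thesis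
    using integral_split[OF discounted_reward_integrable[OF u xs], of 1] ft times_eq
    by (simp add: penalized_return_def ret_eq risk_def integral_below_one discounted_reward_zero[OF u xs]
        zero_ereal_def)
qed

lemma const_controller: "a \<in> controls S \<Longrightarrow> (\<lambda>_. a) \<in> controllers S"
  unfolding controllers_def by (rule measurable_const) (simp add: space_restrict_space)

text \<open>Policy improvement: if the one-step deviation \<open>a\<close> at \<open>y\<close> were profitable, then so would be
  the feedback that always plays \<open>a\<close> at \<open>y\<close>.\<close>

lemma no_profitable_deviation:
  assumes opt: "optimal_penalized S p u" and y: "y \<in> states S" "y \<notin> failure S" and a: "a \<in> controls S"
  shows "reward S y a + gamma S * penalized_value S p (dyn S y a) \<le> penalized_value S p y"
proof (rule ccontr)
  assume contra: "\<not> ?thesis"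
  have u: "u \<in> controllers S" using opt by (simp add: optimal_penalized_def)
  define w where "w = (\<lambda>z. if z \<in> {y} then a else u z)"
  have w: "w \<in> controllers S"
    unfolding w_def by (intro splice_controller const_controller a u borel_closed) simp
  \<comment> \<open>The advantage of \<open>w\<close> over \<open>u\<close>. It is nonpositive by
    optimality of \<open>u\<close>; the aim is to force it to be positive at
    \<open>y\<close>.\<close>
  define d where "d z = penalized_return p z w - penalized_return p z u" for z
  have d_le: "d z \<le> 0" if "z \<in> states S" for z
    using penalized_return_le_value[OF w that, of p] optimal_penalized_return[OF opt that]
    by (simp add: d_def)
  have y': "dyn S y a \<in> states S" using dyn_states y a by blast
  have dy: "gamma S * d (dyn S y a) < d y"
    using contra penalized_return_step[OF w y, of p] optimal_penalized_return[OF opt y(1)]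
      optimal_penalized_return[OF opt y']
    by (simp add: d_def w_def algebra_simps)
  \<comment> \<open>At \<open>y\<close> this is the assumed profit. Elsewhere both feedbacks play
    the same control: outside the failure set the rewards cancel, and on it the returns agree, so
    \<open>d z = 0\<close> while the left side is nonpositive.\<close>
  have step: "gamma S * d (dyn S z (w z)) \<le> d z" if z: "z \<in> states S" for z
  proof -
    consider "z = y" | "z \<noteq> y" "z \<notin> failure S" | "z \<noteq> y" "z \<in> failure S" by blast
    then show ?thesis
    proof cases
      case 1
      then show ?thesis using dy by (simp add: w_def)
    next
      case 2
      then show ?thesis
        using penalized_return_step[OF w z, of p] penalized_return_step[OF u z, of p]
        by (simp add: d_def w_def algebra_simps)
    next
      case 3
      then have "d z = 0"
        using penalized_return_failure[OF w, of z p] penalized_return_failure[OF u, of z p]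
        by (simp add: d_def w_def)
      then show ?thesis
        using d_le[OF dyn_states[OF z control_in[OF w z]]] gamma_pos
        by (simp add: mult_nonneg_nonpos)
    qed
  qed
  obtain B where B: "\<And>x u. u \<in> controllers S \<Longrightarrow> x \<in> states S \<Longrightarrow> \<bar>penalized_return p x u\<bar> \<le> B"
    using penalized_return_bound by blast
  have fs: "flow S w (dyn S y a) (real n) \<in> states S" for n
    using flow_states[OF w y'] times_eq by simp
  \<comment> \<open>The orbit starts after the deviation and may return to \<open>y\<close>, which
    \<open>step\<close> permits. The result \<open>0 \<le> d (dyn S y a)\<close> makes the strict
    inequality \<open>dy\<close> give \<open>0 < d y\<close>.\<close>
  have "0 \<le> d (flow S w (dyn S y a) (real 0))"
  proof (rule nonneg_of_discounted_lower_bound)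
    show "\<bar>d (flow S w (dyn S y a) (real n))\<bar> \<le> 2 * B" for n
      using B[OF w fs, of n] B[OF u fs, of n] by (simp add: d_def)
    show "gamma S * d (flow S w (dyn S y a) (real (Suc n))) \<le> d (flow S w (dyn S y a) (real n))" for n
      unfolding flow_Suc[OF w y'] by (rule step[OF fs])
  qed (use gamma_pos gamma_less_one in auto)
  then have "0 \<le> d (dyn S y a)" using flow_zero[OF w y'] by simp
  then have "0 < d y" using dy gamma_pos by (meson le_less_trans mult_nonneg_nonneg less_imp_le)
  then show False using d_le[OF y(1)] by simp
qed

lemma R_Q_viable_le:
  assumes "(x, a) \<in> Q_viable S"
  shows "R_Q_viable S \<le> reward S x a"
proof -
  obtain B where "0 \<le> B" and B: "\<And>x a. x \<in> states S \<Longrightarrow> a \<in> controls S \<Longrightarrow> \<bar>reward S x a\<bar> \<le> B"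
    using reward_bound by blast
  have "R_Q_viable S \<le> (\<lambda>(x, a). reward S x a) (x, a)"
    unfolding R_Q_viable_def using assms B
    by (intro cINF_lower bdd_belowI2[where m = "- B"]) (force simp: abs_le_iff Q_viable_def)+
  then show ?thesis by simp
qed

lemma reward_le_R_Q_unviable:
  assumes "(x, a) \<in> Q_unviable S"
  shows "reward S x a \<le> R_Q_unviable S"
proof -
  obtain B where "0 \<le> B" and B: "\<And>x a. x \<in> states S \<Longrightarrow> a \<in> controls S \<Longrightarrow> \<bar>reward S x a\<bar> \<le> B"
    using reward_bound by blast
  have "(\<lambda>(x, a). reward S x a) (x, a) \<le> R_Q_unviable S"
    unfolding R_Q_unviable_def using assms B
    by (intro cSUP_upper bdd_aboveI2[where M = B]) (force simp: abs_le_iff Q_unviable_def)+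
  then show ?thesis by simp
qed

lemma dt_safe_value_function:
  assumes gap: "R_Q_unviable S + gamma S * sup_V_pen S p < R_Q_viable S + gamma S * inf_V S"
  shows "safe_value_function S p"
proof (rule safe_value_functionI, rule notI)
  fix u x t
  assume opt: "optimal_penalized S p u" and xv: "x \<in> viable S"
    and t: "t \<in> times S" "flow S u x t \<in> failure S"
  have u: "u \<in> controllers S" using opt by (simp add: optimal_penalized_def)
  have x: "x \<in> states S" using xv viable_subset by blast
  obtain n where n: "flow S u x (real n) \<in> failure S"
    using t by (auto simp: times_eq Nats_def)
  \<comment> \<open>The trajectory starts viable and contains a failed, hence nonviable, state, so
    some single step leaves the viable set.\<close>
  have "\<exists>k. flow S u x (real k) \<in> viable S \<and> flow S u x (real (Suc k)) \<notin> viable S"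
  proof (rule ccontr)
    assume no: "\<not> ?thesis"
    have "flow S u x (real k) \<in> viable S" for k
    proof (induction k)
      case 0
      then show ?case using xv flow_zero[OF u x] by simp
    next
      case (Suc k)
      then show ?case using no by blast
    qed
    then show False using n failure_not_viable by blast
  qed
  then obtain k where k: "flow S u x (real k) \<in> viable S" "flow S u x (real (Suc k)) \<notin> viable S"
    by blast
  define y where "y = flow S u x (real k)"
  have yv: "y \<in> viable S" using k by (simp add: y_def)
  then have y: "y \<in> states S" "y \<notin> failure S" using viable_subset failure_not_viable by auto
  have nv: "dyn S y (u y) \<notin> viable S" using k flow_Suc[OF u x] by (simp add: y_def)
  have ns: "dyn S y (u y) \<in> states S" using dyn_states[OF y(1) control_in[OF u y(1)]] .
  obtain v where v: "v \<in> safe_controllers S" using safe_controllers_nonempty by blast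
  then have vc: "v \<in> controllers S" and vs: "safe_for S y v"
    using yv by (auto simp: safe_controllers_def)
  have vv: "dyn S y (v y) \<in> viable S"
    using viable_flow[OF yv vc vs, of 1] flow_one[OF vc y(1)] by (simp add: times_eq)
  \<comment> \<open>At \<open>y\<close> the pair played by \<open>u\<close> lies in
    \<open>Q_unviable\<close> and the one played by the safe \<open>v\<close> in
    \<open>Q_viable\<close>; this is where the one-step rewards in \<open>gap\<close> come
    from.\<close>
  have "penalized_value S p y = reward S y (u y) + gamma S * penalized_value S p (dyn S y (u y))"
    using penalized_return_step[OF u y, of p] optimal_penalized_return[OF opt] y ns by simp
  also have "\<dots> \<le> R_Q_unviable S + gamma S * sup_V_pen S p"
    using reward_le_R_Q_unviable[of y "u y"] penalized_value_le_sup_V_pen[of "dyn S y (u y)" p]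
      nv ns y control_in[OF u] gamma_pos
    by (intro add_mono mult_left_mono) (auto simp: Q_unviable_def Q_viable_def unviable_def)
  also have "\<dots> < R_Q_viable S + gamma S * inf_V S" by (rule gap)
  also have "\<dots> \<le> reward S y (v y) + gamma S * penalized_value S p (dyn S y (v y))"
    using R_Q_viable_le[of y "v y"] inf_V_le_penalized_value[OF vv] vv y control_in[OF vc] gamma_pos
    by (intro add_mono mult_left_mono) (auto simp: Q_viable_def)
  also have "\<dots> \<le> penalized_value S p y"
    by (rule no_profitable_deviation[OF opt y control_in[OF vc y(1)]])
  finally show False by simp
qed

text \<open>A geometric sum of \<open>n + 1\<close> terms, the last one for the failure time itself,
  rewritten to be affine in the discount at \<open>t\<close>.\<close>

lemma discount_upto_eq:
  assumes "t \<in> times S"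
  shows "discount_upto t = 1 / (1 - gamma S) - gamma S / (1 - gamma S) * exp (- t / tau S)"
proof -
  obtain n where n: "t = real n" using assms by (auto simp: times_eq Nats_def)
  have "discount_upto t =
      (\<integral>s. indicator {..<real (Suc n)} s * exp (- s / tau S) \<partial>time_measure S)"
    unfolding discount_upto_def n time_measure_eq
    by (rule Bochner_Integration.integral_cong) (auto simp: indicator_def Nats_def)
  also have "\<dots> = (\<Sum>k<Suc n. gamma S ^ k)"
    unfolding time_measure_eq integral_count_space_Nats_below exp_eq_gamma_power ..
  also have "\<dots> = (1 - gamma S ^ Suc n) / (1 - gamma S)"
    using gamma_less_one sum_gp_strict[of "gamma S" "Suc n"] by simp
  finally show ?thesis
    unfolding n exp_eq_gamma_power by (simp add: diff_divide_distrib)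
qed

end

section \<open>Explicit thresholds\<close>

text \<open>If the threshold of time 0 is the larger one, then \<open>A / q < A\<close> with
  \<open>q \<le> 1\<close> forces \<open>A < 0\<close>; together with \<open>0 \<le> R\<close> both
  thresholds are then at most 0 and are absorbed by the \<open>0\<close> in the maximum.\<close>

lemma Max_thresholds:
  fixes A b q R :: real
  assumes "0 < q" "q \<le> 1" "0 \<le> b" and "0 \<le> R \<or> A - R * b \<le> A / q - R * b"
  shows "Max {0, A - R * b, A / q - R * b} = max 0 (A / q - R * b)"
proof (cases "A - R * b \<le> A / q - R * b")
  case True
  then show ?thesis by simp
next
  case False
  then have "A / q < A" "0 \<le> R * b" using assms by auto
  moreover have "A \<le> A / q" if "0 \<le> A"
    using that assms mult_left_le[of q A] by (simp add: field_simps)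
  ultimately have "A - R * b \<le> 0" by linarith
  then show ?thesis by simp
qed

lemma ct_penalty_threshold:
  fixes S :: "('x::euclidean_space, 'u::euclidean_space) control_problem"
  assumes ct: "ct_dynamics S" and st: "standing_assumptions S" and T: "0 \<le> T"
    and ft: "\<forall>x\<in>unviable S. \<forall>u\<in>controllers S. failure_time S x u \<le> ereal T"
  shows "0 \<le> R_unviable S \<or> ct_threshold S 0 \<le> ct_threshold S T \<longrightarrow>
      Max {0, ct_threshold S 0, ct_threshold S T} = max 0 (ct_threshold S T)"
    and "Max {0, ct_threshold S 0, ct_threshold S T} < p \<Longrightarrow>
      safe_value_function S p \<and> sup_V_pen S p < inf_V S"
proof -
  interpret controlled_flow S using ct st by (rule ct_controlled_flow)
  have M: "time_measure S = lebesgue_on {0..}" using ct by (simp add: ct_dynamics_def)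
  let ?A = "R_unviable S * tau S - inf_V S" and ?q = "exp (- T / tau S)"
  have thr: "ct_threshold S 0 = ?A - R_unviable S * tau S"
    "ct_threshold S T = ?A / ?q - R_unviable S * tau S"
    by (simp_all add: ct_threshold_def exp_minus divide_inverse)
  have q: "0 < ?q" "?q \<le> 1" using tau_pos T by auto
  show "0 \<le> R_unviable S \<or> ct_threshold S 0 \<le> ct_threshold S T \<longrightarrow>
      Max {0, ct_threshold S 0, ct_threshold S T} = max 0 (ct_threshold S T)"
    unfolding thr using Max_thresholds[OF q, of "tau S" "R_unviable S" ?A] tau_pos by simp
  assume p: "Max {0, ct_threshold S 0, ct_threshold S T} < p"
  \<comment> \<open>The total mass \<open>tau S\<close> minus the tail after \<open>t\<close>, which
    is the total mass scaled by the discount at \<open>t\<close>. So both constants of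
    \<open>sup_V_pen_less\<close> are \<open>tau S\<close>.\<close>
  have upto: "discount_upto t = tau S - tau S * exp (- t / tau S)" if "t \<in> times S" for t
  proof -
    have t: "0 \<le> t" using time_nonneg[OF that] .
    let ?e = "\<lambda>t. exp (- t / tau S)"
    have e: "integrable (lebesgue_on {0..}) ?e" "integral\<^sup>L (lebesgue_on {0..}) ?e = tau S"
      using has_bochner_integral_exp_halfline[OF tau_pos] by (auto simp: has_bochner_integral_iff)
    have "(\<integral>s. ?e (t + s) \<partial>lebesgue_on {0..}) = (\<integral>s. ?e t * ?e s \<partial>lebesgue_on {0..})"
      by (rule Bochner_Integration.integral_cong)
         (simp_all add: mult_exp_exp add_divide_distrib diff_divide_distrib)
    also have "\<dots> = ?e t * tau S" using e by simp
    finally show ?thesis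
      using lebesgue_halfline_split[OF e(1) t] lebesgue_halfline_upto[OF e(1) t, of "{..t}"]
        lebesgue_halfline_upto[OF e(1) t, of "{..<t}"] e(2)
      by (simp add: discount_upto_def M eq_diff_eq mult.commute)
  qed
  have "sup_V_pen S p < inf_V S"
    by (rule sup_V_pen_less[OF _ upto, where T = T]) (use p ft in \<open>auto simp: thr\<close>)
  then show "safe_value_function S p \<and> sup_V_pen S p < inf_V S"
    using ct_safe_value_function[OF ct st] by blast
qed

lemma dt_penalty_threshold:
  fixes S :: "('x::t1_space, 'u::topological_space) control_problem"
  assumes dt: "dt_dynamics S" and st: "standing_assumptions S"
    and ft: "\<forall>x\<in>unviable S. \<forall>u\<in>controllers S. failure_time S x u \<le> ereal (real T)"
  shows "0 \<le> R_unviable S \<or> dt_threshold S 0 \<le> dt_threshold S T \<longrightarrow>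
      Max {0, dt_threshold S 0, dt_threshold S T} = max 0 (dt_threshold S T)"
    and "Max {0, dt_threshold S 0, dt_threshold S T} < p \<Longrightarrow>
      safe_value_function S p \<and>
      R_Q_unviable S + gamma S * sup_V_pen S p < R_Q_viable S + gamma S * inf_V S"
proof -
  interpret discrete_flow S using dt st by (rule discrete_flow.intro)
  let ?g = "gamma S" and ?R = "R_unviable S"
  \<comment> \<open>The zeroth-order condition solved for \<open>sup_V_pen S p\<close>: it is
    equivalent to \<open>sup_V_pen S p < c\<close>.\<close>
  define c where "c = inf_V S + (R_Q_viable S - R_Q_unviable S) / ?g"
  define A where "A = ?R * (1 / (1 - ?g)) - c"
  define b where "b = ?g / (1 - ?g)"
  note g = gamma_pos gamma_less_one
  \<comment> \<open>The reward factor equals \<open>1 / (1 - ?g) - b * ?g ^ n\<close>, so division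
    by \<open>?g ^ n\<close> turns its second term into a constant and gives the same shape as in
    continuous time.\<close>
  have "dt_threshold S n = A / ?g ^ n - ?R * b" for n
  proof -
    have "?R * ((1 - ?g ^ (n + 1)) / (1 - ?g)) + (R_Q_unviable S - R_Q_viable S) / ?g - inf_V S =
        A - ?R * b * ?g ^ n"
      by (simp add: A_def b_def c_def diff_divide_distrib algebra_simps)
    then show ?thesis using g by (simp add: dt_threshold_def diff_divide_distrib)
  qed
  from this[of 0] this[of T] have thr: "dt_threshold S 0 = A - ?R * b"
    "dt_threshold S T = A / ?g ^ T - ?R * b" by simp_all
  have q: "0 < ?g ^ T" "?g ^ T \<le> 1" using g by (auto simp: power_le_one)
  show "0 \<le> ?R \<or> dt_threshold S 0 \<le> dt_threshold S T \<longrightarrow>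
      Max {0, dt_threshold S 0, dt_threshold S T} = max 0 (dt_threshold S T)"
    unfolding thr using Max_thresholds[OF q, of b ?R A] g by (simp add: b_def)
  assume p: "Max {0, dt_threshold S 0, dt_threshold S T} < p"
  have "sup_V_pen S p < c"
  proof (rule sup_V_pen_less[where T = "real T"])
    show "discount_upto t = 1 / (1 - ?g) - b * exp (- t / tau S)" if "t \<in> times S" for t
      using discount_upto_eq[OF that] by (simp add: b_def)
  qed (use p ft in \<open>unfold exp_eq_gamma_power, auto simp: thr A_def\<close>)
  then have "?g * sup_V_pen S p < ?g * c" using g by simp
  also have "\<dots> = ?g * inf_V S + (R_Q_viable S - R_Q_unviable S)"
    using g by (simp add: c_def distrib_left)
  finally have gap: "R_Q_unviable S + ?g * sup_V_pen S p < R_Q_viable S + ?g * inf_V S" by simp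
  then show "safe_value_function S p \<and>
      R_Q_unviable S + ?g * sup_V_pen S p < R_Q_viable S + ?g * inf_V S"
    using dt_safe_value_function by blast
qed

text \<open>The \<open>0\<close> in the maximum makes \<open>pstar\<close> an admissible penalty,
  and the threshold of time 0 accounts for states that fail at once. The middle conjunct records
  conditions under which the threshold of the time bound, truncated at 0, is the whole
  maximum.\<close>

theorem theorem2:
  fixes C :: "('x::euclidean_space, 'u::euclidean_space) control_problem"
    and D :: "('y::t1_space, 'v::topological_space) control_problem"
    and T\<^sub>C :: real and T\<^sub>D :: nat
  shows
    "(ct_dynamics C \<and> standing_assumptions C \<and> 0 \<le> T\<^sub>C \<and>
      (\<forall>x\<in>unviable C. \<forall>u\<in>controllers C. failure_time C x u \<le> ereal T\<^sub>C)
      \<longrightarrow>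
      (\<exists>pstar\<ge>0.
         pstar = Max {0, ct_threshold C 0, ct_threshold C T\<^sub>C} \<and>
         (0 \<le> R_unviable C \<or> ct_threshold C 0 \<le> ct_threshold C T\<^sub>C \<longrightarrow>
            pstar = max 0 (ct_threshold C T\<^sub>C)) \<and>
         (\<forall>p>pstar. safe_value_function C p \<and> sup_V_pen C p < inf_V C)))
     \<and>
     (dt_dynamics D \<and> standing_assumptions D \<and>
      (\<forall>x\<in>unviable D. \<forall>u\<in>controllers D. failure_time D x u \<le> ereal (real T\<^sub>D))
      \<longrightarrow>
      (\<exists>pstar\<ge>0.
         pstar = Max {0, dt_threshold D 0, dt_threshold D T\<^sub>D} \<and>
         (0 \<le> R_unviable D \<or> dt_threshold D 0 \<le> dt_threshold D T\<^sub>D \<longrightarrow>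
            pstar = max 0 (dt_threshold D T\<^sub>D)) \<and>
         (\<forall>p>pstar. safe_value_function D p \<and>
            R_Q_unviable D + gamma D * sup_V_pen D p < R_Q_viable D + gamma D * inf_V D)))"
proof (intro conjI impI, goal_cases)
  case 1
  then have C: "ct_dynamics C" "standing_assumptions C" "0 \<le> T\<^sub>C"
    "\<forall>x\<in>unviable C. \<forall>u\<in>controllers C. failure_time C x u \<le> ereal T\<^sub>C" by auto
  show ?case
    using ct_penalty_threshold[OF C] by (intro exI[of _ "Max {0, ct_threshold C 0, ct_threshold C T\<^sub>C}"]) auto
next
  case 2
  then have D: "dt_dynamics D" "standing_assumptions D"
    "\<forall>x\<in>unviable D. \<forall>u\<in>controllers D. failure_time D x u \<le> ereal (real T\<^sub>D)" by auto
  show ?case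
    using dt_penalty_threshold[OF D] by (intro exI[of _ "Max {0, dt_threshold D 0, dt_threshold D T\<^sub>D}"]) auto
qed

end
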